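(* Let $T>0$, let $W$ be a standard Brownian motion defined on a probability space $(\Omega,\mathcal{A},\mathbb{P})$, and let $f:[0,T]\to\mathbb{R}$ satisfy $(L_{\rho,a})$ for a couple $(\rho,a)\in(0,1]\times(0,+\infty)$. Let $X_t=\int_0^tf(t-s)\,dW_s$, $t\in[0,T]$, be the associated continuous Liouville process. If furthermore $f$ is nonnegative Lebesgue-a.e., then $X$ satisfies a functional co-monotony principle on $\mathcal{C}([0,T],\mathbb{R})$.
   Context: Condition $(L_{\rho,a})$: there exist $\varphi\in\mathcal{L}^2([0,T],dt)$ and a real constant $[f]_{\rho,\varphi}$ such that (i) $|f(t)-f(t')|\le[f]_{\rho,\varphi}|t-t'|^\rho\varphi(t\wedge t')$ for all $t,t'\in[0,T]$, and (ii) $\int_0^tf^2(s)\,ds=O(t^a)$. Under this condition the Gaussian process $X_t=\int_0^tf(t-s)\,dW_s$, $t\in[0,T]$, admits a continuous modification, called the (continuous) Liouville process related to $f$; $X$ denotes this modification. $\mathcal{C}([0,T],\mathbb{R})$ is equipped with the sup-norm, its Borel $\sigma$-field, and the pointwise order: $\alpha\le\beta$ if $\alpha(t)\le\beta(t)$ for all $t\in[0,T]$. Two measurable functionals $F,G$ on this space are co-monotone if they are both non-decreasing or both non-increasing for this order. $F$ is $\mathbb{P}_X$-a.s. continuous if it is sup-norm continuous at every point of a set of probability $1$ under the distribution $\mathbb{P}_X$ of $X$. $X$ satisfies a functional co-monotony principle on $\mathcal{C}([0,T],\mathbb{R})$ if, for every pair of bounded, co-monotone, $\mathbb{P}_X$-a.s.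 continuous, measurable functionals $F,G:\mathcal{C}([0,T],\mathbb{R})\to\mathbb{R}$, $\mathbb{E}\,F(X)G(X)\ge\mathbb{E}\,F(X)\,\mathbb{E}\,G(X)$. *)

theory Defs
  imports "HOL-Probability.Probability"
begin

section \<open>Standard Brownian motion on \<open>[0,T]\<close>\<close>

(* Only W on [0,T] is constrained, so a Brownian motion on [0,oo) is covered as well. *)
definition standard_brownian_motion :: "'w measure \<Rightarrow> real \<Rightarrow> (real \<Rightarrow> 'w \<Rightarrow> real) \<Rightarrow> bool" where
  "standard_brownian_motion M T W \<longleftrightarrow>
     prob_space M \<and>
     (\<forall>t\<in>{0..T}. W t \<in> borel_measurable M) \<and>
     (AE \<omega> in M. W 0 \<omega> = 0) \<and>
     (AE \<omega> in M. continuous_on {0..T} (\<lambda>t. W t \<omega>)) \<and>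
     (\<forall>s t. 0 \<le> s \<and> s < t \<and> t \<le> T \<longrightarrow>
        distributed M lborel (\<lambda>\<omega>. W t \<omega> - W s \<omega>) (normal_density 0 (sqrt (t - s)))) \<and>
     (\<forall>(n::nat) u. (\<forall>i\<le>n. u i \<in> {0..T}) \<and> (\<forall>i<n. u i \<le> u (Suc i)) \<longrightarrow>
        prob_space.indep_vars M (\<lambda>_. borel) (\<lambda>i \<omega>. W (u (Suc i)) \<omega> - W (u i) \<omega>) {..<n})"


section \<open>The Wiener integral of a deterministic function\<close>

(* A step function is given by its number of steps n, nodes u 0 <= ... <= u n and values c i. *)
definition step_nodes :: "real \<Rightarrow> nat \<Rightarrow> (nat \<Rightarrow> real) \<Rightarrow> bool" where
  "step_nodes t n u \<longleftrightarrow> (\<forall>i\<le>n. u i \<in> {0..t}) \<and> (\<forall>i<n. u i \<le> u (Suc i))"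

definition step_fun :: "nat \<Rightarrow> (nat \<Rightarrow> real) \<Rightarrow> (nat \<Rightarrow> real) \<Rightarrow> real \<Rightarrow> real" where
  "step_fun n u c s = (\<Sum>i<n. c i * indicator {u i<..u (Suc i)} s)"

definition step_integral ::
    "(real \<Rightarrow> 'w \<Rightarrow> real) \<Rightarrow> nat \<Rightarrow> (nat \<Rightarrow> real) \<Rightarrow> (nat \<Rightarrow> real) \<Rightarrow> 'w \<Rightarrow> real" where
  "step_integral W n u c \<omega> = (\<Sum>i<n. c i * (W (u (Suc i)) \<omega> - W (u i) \<omega>))"

(* Y is (a version of) the integral of g over [0,t] with respect to W: the L2(P)-limit of the
   integrals of step functions converging to g in L2([0,t]).  By the Ito isometry Y does not
   depend on the approximating sequence, up to almost sure equality. *)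
definition has_wiener_integral ::
    "'w measure \<Rightarrow> (real \<Rightarrow> 'w \<Rightarrow> real) \<Rightarrow> real \<Rightarrow> (real \<Rightarrow> real) \<Rightarrow> ('w \<Rightarrow> real) \<Rightarrow> bool" where
  "has_wiener_integral M W t g Y \<longleftrightarrow>
     g \<in> borel_measurable (lebesgue_on {0..t}) \<and>
     Y \<in> borel_measurable M \<and>
     (\<exists>(n :: nat \<Rightarrow> nat) (u :: nat \<Rightarrow> nat \<Rightarrow> real) (c :: nat \<Rightarrow> nat \<Rightarrow> real).
        (\<forall>k. step_nodes t (n k) (u k)) \<and>
        ((\<lambda>k. \<integral>\<^sup>+ s. ennreal ((step_fun (n k) (u k) (c k) s - g s)\<^sup>2) \<partial>lebesgue_on {0..t})
           \<longlonglongrightarrow> 0) \<and>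
        ((\<lambda>k. \<integral>\<^sup>+ \<omega>. ennreal ((step_integral W (n k) (u k) (c k) \<omega> - Y \<omega>)\<^sup>2) \<partial>M)
           \<longlonglongrightarrow> 0))"


section \<open>Liouville processes\<close>

(* The domain of f and \<phi> is [0,T]; their values elsewhere are irrelevant.  The O-term is meant
   for t tending to 0 from the right.  Taking t' = T in the Hoelder-type bound shows that f is
   square integrable on [0,T], and the bound makes f right-continuous, hence measurable, there,
   so the Bochner integral below is a genuine one. *)
definition L_condition :: "real \<Rightarrow> real \<Rightarrow> real \<Rightarrow> (real \<Rightarrow> real) \<Rightarrow> bool" where
  "L_condition T \<rho> a f \<longleftrightarrow>
     (\<exists>\<phi> C. \<phi> \<in> borel_measurable (lebesgue_on {0..T}) \<and>
        integrable (lebesgue_on {0..T}) (\<lambda>t. (\<phi> t)\<^sup>2) \<and>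
        (\<forall>t\<in>{0..T}. \<forall>t'\<in>{0..T}. \<bar>f t - f t'\<bar> \<le> C * \<bar>t - t'\<bar> powr \<rho> * \<phi> (min t t'))) \<and>
     (\<lambda>t. LINT s|lebesgue_on {0..t}. (f s)\<^sup>2) \<in> O[at_right 0](\<lambda>t. t powr a)"

definition continuous_liouville_process ::
    "'w measure \<Rightarrow> (real \<Rightarrow> 'w \<Rightarrow> real) \<Rightarrow> real \<Rightarrow> (real \<Rightarrow> real) \<Rightarrow> (real \<Rightarrow> 'w \<Rightarrow> real) \<Rightarrow> bool" where
  "continuous_liouville_process M W T f X \<longleftrightarrow>
     (\<forall>t\<in>{0..T}. has_wiener_integral M W t (\<lambda>s. f (t - s)) (X t)) \<and>
     (\<forall>\<omega>\<in>space M. continuous_on {0..T} (\<lambda>t. X t \<omega>))"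


section \<open>Functional co-monotony on \<open>C([0,T])\<close>\<close>

(* C([0,T]) with the sup-metric; its points are extensional functions on {0..T}. *)
definition C_metric :: "real \<Rightarrow> (real \<Rightarrow> real) metric" where
  "C_metric T = cfunspace (top_of_set {0..T}) euclidean_metric"

definition C_borel :: "real \<Rightarrow> (real \<Rightarrow> real) measure" where
  "C_borel T = sigma (mspace (C_metric T)) {U. openin (mtopology_of (C_metric T)) U}"

definition path :: "real \<Rightarrow> (real \<Rightarrow> 'w \<Rightarrow> real) \<Rightarrow> 'w \<Rightarrow> (real \<Rightarrow> real)" where
  "path T X \<omega> = restrict (\<lambda>t. X t \<omega>) {0..T}"

definition C_nondecreasing :: "real \<Rightarrow> ((real \<Rightarrow> real) \<Rightarrow> real) \<Rightarrow> bool" where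
  "C_nondecreasing T F \<longleftrightarrow>
     (\<forall>\<alpha>\<in>mspace (C_metric T). \<forall>\<beta>\<in>mspace (C_metric T).
        (\<forall>t\<in>{0..T}. \<alpha> t \<le> \<beta> t) \<longrightarrow> F \<alpha> \<le> F \<beta>)"

definition C_nonincreasing :: "real \<Rightarrow> ((real \<Rightarrow> real) \<Rightarrow> real) \<Rightarrow> bool" where
  "C_nonincreasing T F \<longleftrightarrow>
     (\<forall>\<alpha>\<in>mspace (C_metric T). \<forall>\<beta>\<in>mspace (C_metric T).
        (\<forall>t\<in>{0..T}. \<alpha> t \<le> \<beta> t) \<longrightarrow> F \<beta> \<le> F \<alpha>)"

definition co_monotone :: "real \<Rightarrow> ((real \<Rightarrow> real) \<Rightarrow> real) \<Rightarrow> ((real \<Rightarrow> real) \<Rightarrow> real) \<Rightarrow> bool" where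
  "co_monotone T F G \<longleftrightarrow>
     (C_nondecreasing T F \<and> C_nondecreasing T G) \<or> (C_nonincreasing T F \<and> C_nonincreasing T G)"

definition as_continuous ::
    "'w measure \<Rightarrow> real \<Rightarrow> (real \<Rightarrow> 'w \<Rightarrow> real) \<Rightarrow> ((real \<Rightarrow> real) \<Rightarrow> real) \<Rightarrow> bool" where
  "as_continuous M T X F \<longleftrightarrow>
     (AE x in distr M (C_borel T) (path T X).
        topcontinuous_at (mtopology_of (C_metric T)) euclideanreal F x)"

definition functional_co_monotony_principle ::
    "'w measure \<Rightarrow> real \<Rightarrow> (real \<Rightarrow> 'w \<Rightarrow> real) \<Rightarrow> bool" where
  "functional_co_monotony_principle M T X \<longleftrightarrow>
     (\<forall>F G. F \<in> borel_measurable (C_borel T) \<and> G \<in> borel_measurable (C_borel T) \<and>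
        bounded (F ` mspace (C_metric T)) \<and> bounded (G ` mspace (C_metric T)) \<and>
        co_monotone T F G \<and> as_continuous M T X F \<and> as_continuous M T X G \<longrightarrow>
        (LINT \<omega>|M. F (path T X \<omega>) * G (path T X \<omega>))
          \<ge> (LINT \<omega>|M. F (path T X \<omega>)) * (LINT \<omega>|M. G (path T X \<omega>)))"

end

(*
  X is approximated by Y_N(t) = sum_k A_{N,k} B_{N,k}(t/T), where the B_{N,k} are the Bernstein
  polynomials and A_{N,k} is a step integral with nonnegative coefficients that is close in L2 to
  X(kT/N); such a step integral exists because f >= 0.  Since the X-version of this sum converges
  uniformly on every path, a summable choice of the L2 errors makes Y_N converge to X uniformly
  almost surely, hence F(Y_N) -> F(X) almost surely.  As a functional of finitely many independent
  Brownian increments, F(Y_N) is monotone in each of them, so the inequality for Y_N is Harris'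
  inequality for product measures; dominated convergence gives it for X.  Gaussianity enters only
  through the isometry for step functions.
*)
theory Submission
  imports Defs
begin

section \<open>The space of continuous paths\<close>

text \<open>The obstacle is that \<open>F\<close> and \<open>G\<close> live on whole paths, while
  Harris' inequality speaks of finitely many independent numbers. An approximation must be a
  continuous path, be pointwise nondecreasing in independent variables, and converge in sup-norm.
  Bernstein polynomials fit because they are continuous, nonnegative on the unit interval and of sum
  1: nonnegativity preserves the order, and the sum 1 means that errors in the coefficients are
  averaged, never amplified. The values X(kT/N) are in general dependent, so each is replaced by a
  step integral. The step integrals for different k have different nodes, and only a common
  refinement makes all of them nonnegative combinations of the same independent increments.
  Continuity of \<open>F\<close> and \<open>G\<close> is available at almost every path of
  \<open>X\<close> but not at the paths Y_N. Hence it serves only for convergence towards X, and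
  F(Y_N) is controlled through Borel measurability alone, which is why maps into
  \<open>C_borel\<close> receive so much attention.\<close>

lemma mspace_C_metric:
  "mspace (C_metric T) = {x \<in> extensional {0..T}. continuous_on {0..T} x}"
proof -
  have "bounded (x ` {0..T})" if "continuous_on {0..T} x" for x :: "real \<Rightarrow> real"
    using that by (intro compact_imp_bounded compact_continuous_image) auto
  then show ?thesis
    by (auto simp: C_metric_def mbounded_iff_bounded)
qed

text \<open>The assumption \<open>0 \<le> T\<close> keeps the interval nonempty; otherwise the right
  side would hold for every \<open>r\<close>.\<close>

lemma mdist_C_metric_le:
  assumes "0 \<le> T" "x \<in> mspace (C_metric T)" "y \<in> mspace (C_metric T)"
  shows "mdist (C_metric T) x y \<le> r \<longleftrightarrow> (\<forall>t\<in>{0..T}. \<bar>x t - y t\<bar> \<le> r)"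
  using assms unfolding C_metric_def
  by (subst cfunspace_mdist_le) (auto simp: dist_real_def)

text \<open>Pointwise bounds replace the sup-metric, so that later arguments need not mention
  \<open>mdist\<close>. The non-strict \<open>\<le>\<close> is matched with strict balls by halving
  the radius.\<close>

lemma openin_C_metric_iff:
  assumes "0 \<le> T"
  shows "openin (mtopology_of (C_metric T)) U \<longleftrightarrow>
    U \<subseteq> mspace (C_metric T) \<and>
    (\<forall>x\<in>U. \<exists>r>0. \<forall>y\<in>mspace (C_metric T). (\<forall>t\<in>{0..T}. \<bar>x t - y t\<bar> \<le> r) \<longrightarrow> y \<in> U)"
proof -
  interpret C: Metric_space "mspace (C_metric T)" "mdist (C_metric T)"
    by (rule Metric_space_mspace_mdist)
  have ball: "(\<exists>r>0. C.mball x r \<subseteq> U) \<longleftrightarrow>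
      (\<exists>r>0. \<forall>y\<in>mspace (C_metric T). (\<forall>t\<in>{0..T}. \<bar>x t - y t\<bar> \<le> r) \<longrightarrow> y \<in> U)"
    if "x \<in> mspace (C_metric T)" for x
  proof
    assume "\<exists>r>0. C.mball x r \<subseteq> U"
    then obtain r where r: "r > 0" "C.mball x r \<subseteq> U" by blast
    have "y \<in> U" if y: "y \<in> mspace (C_metric T)" "\<forall>t\<in>{0..T}. \<bar>x t - y t\<bar> \<le> r / 2" for y
    proof -
      have "mdist (C_metric T) x y \<le> r / 2"
        using mdist_C_metric_le[OF assms \<open>x \<in> _\<close> y(1)] y(2) by blast
      then show ?thesis using r y(1) \<open>x \<in> _\<close> by (auto simp: subset_iff)
    qed
    then show "\<exists>r>0. \<forall>y\<in>mspace (C_metric T). (\<forall>t\<in>{0..T}. \<bar>x t - y t\<bar> \<le> r) \<longrightarrow> y \<in> U"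
      using r(1) by (intro exI[of _ "r / 2"]) auto
  next
    assume "\<exists>r>0. \<forall>y\<in>mspace (C_metric T). (\<forall>t\<in>{0..T}. \<bar>x t - y t\<bar> \<le> r) \<longrightarrow> y \<in> U"
    then obtain r where r: "r > 0"
      "\<And>y. y \<in> mspace (C_metric T) \<Longrightarrow> (\<forall>t\<in>{0..T}. \<bar>x t - y t\<bar> \<le> r) \<Longrightarrow> y \<in> U" by blast
    have "C.mball x r \<subseteq> U"
    proof
      fix y assume "y \<in> C.mball x r"
      then have "y \<in> mspace (C_metric T)" "mdist (C_metric T) x y \<le> r" by auto
      then show "y \<in> U" using mdist_C_metric_le[OF assms \<open>x \<in> _\<close>] r(2) by blast
    qed
    then show "\<exists>r>0. C.mball x r \<subseteq> U" using r(1) by blast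
  qed
  show ?thesis
    unfolding mtopology_of_def C.openin_mtopology using ball by blast
qed

section \<open>Borel sets, limits of paths and measurable path-valued maps\<close>

lemma openin_C_subset: "openin (mtopology_of (C_metric T)) U \<Longrightarrow> U \<subseteq> mspace (C_metric T)"
  using openin_subset[of "mtopology_of (C_metric T)" U] by simp

lemma space_C_borel [simp]: "space (C_borel T) = mspace (C_metric T)"
  unfolding C_borel_def by (rule space_measure_of) (auto dest: openin_C_subset)

lemma sets_C_borel:
  "sets (C_borel T) = sigma_sets (mspace (C_metric T)) {U. openin (mtopology_of (C_metric T)) U}"
  unfolding C_borel_def by (rule sets_measure_of) (auto dest: openin_C_subset)

lemma measurable_C_borelI:
  assumes "\<And>x. x \<in> space N \<Longrightarrow> h x \<in> mspace (C_metric T)"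
    and "\<And>U. openin (mtopology_of (C_metric T)) U \<Longrightarrow> h -` U \<inter> space N \<in> sets N"
  shows "h \<in> measurable N (C_borel T)"
  using assms by (intro measurable_sigma_sets[OF sets_C_borel]) (auto dest: openin_C_subset)

text \<open>Continuity is asked for at the limit \<open>x\<close> alone, since almost sure
  continuity under the law of \<open>X\<close> says nothing about the approximating paths
  \<open>y n\<close>.\<close>

lemma topcontinuous_at_C_tendsto:
  assumes "0 \<le> T"
    and F: "topcontinuous_at (mtopology_of (C_metric T)) euclideanreal F x"
    and y: "\<And>n. y n \<in> mspace (C_metric T)"
    and lim: "uniform_limit {0..T} y x sequentially"
  shows "(\<lambda>n. F (y n)) \<longlonglongrightarrow> F x"
proof (rule topological_tendstoI)
  fix V assume "open V" "F x \<in> V"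
  then obtain U where U: "openin (mtopology_of (C_metric T)) U" "x \<in> U" "\<And>y. y \<in> U \<Longrightarrow> F y \<in> V"
    using F unfolding topcontinuous_at_def by (metis open_openin)
  then obtain r where r: "r > 0"
    "\<And>y. y \<in> mspace (C_metric T) \<Longrightarrow> (\<forall>t\<in>{0..T}. \<bar>x t - y t\<bar> \<le> r) \<Longrightarrow> y \<in> U"
    using openin_C_metric_iff[OF assms(1)] by metis
  have "\<forall>\<^sub>F n in sequentially. \<forall>t\<in>{0..T}. dist (y n t) (x t) < r"
    using lim r(1) by (simp add: uniform_limit_iff)
  then show "\<forall>\<^sub>F n in sequentially. F (y n) \<in> V"
  proof eventually_elim
    case (elim n)
    then have "\<forall>t\<in>{0..T}. \<bar>x t - y n t\<bar> \<le> r" by (force simp: dist_real_def)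
    then show ?case using r(2)[OF y] U(3) by blast
  qed
qed

text \<open>Membership of the limit in an open set is expressed by countably many conditions on the
  approximations. This yields Borel measurability of the path map of \<open>X\<close> without
  identifying the Borel field with the cylinder field.\<close>

lemma measurable_C_borel_uniform_limit:
  assumes "0 \<le> T"
    and Y: "\<And>n. Y n \<in> measurable N (C_borel T)"
    and Z: "\<And>\<omega>. \<omega> \<in> space N \<Longrightarrow> Z \<omega> \<in> mspace (C_metric T)"
    and lim: "\<And>\<omega>. \<omega> \<in> space N \<Longrightarrow> uniform_limit {0..T} (\<lambda>n. Y n \<omega>) (Z \<omega>) sequentially"
  shows "Z \<in> measurable N (C_borel T)"
proof (rule measurable_C_borelI)
  let ?C = "mspace (C_metric T)"
  fix U assume U: "openin (mtopology_of (C_metric T)) U"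
  \<comment> \<open>\<open>V j\<close> is \<open>U\<close> shrunk by a margin exceeding 1/(j+1).
    Without a margin, a limit of points of \<open>U\<close> could lie on its boundary. Requiring
    strictly more than 1/(j+1) makes \<open>V j\<close> open: moving by half of the excess still
    leaves an admissible radius.\<close>
  define V where "V j = {x \<in> ?C. \<exists>e > 1 / real (Suc j).
      \<forall>y\<in>?C. (\<forall>t\<in>{0..T}. \<bar>x t - y t\<bar> \<le> e) \<longrightarrow> y \<in> U}" for j
  have V: "openin (mtopology_of (C_metric T)) (V j)" for j
    unfolding openin_C_metric_iff[OF assms(1)]
  proof safe
    fix x assume "x \<in> V j" then show "x \<in> ?C" by (simp add: V_def)
  next
    fix x assume "x \<in> V j"
    then obtain e where x: "x \<in> ?C" and e: "e > 1 / real (Suc j)"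
      and *: "\<And>y. y \<in> ?C \<Longrightarrow> (\<forall>t\<in>{0..T}. \<bar>x t - y t\<bar> \<le> e) \<Longrightarrow> y \<in> U"
      by (auto simp: V_def)
    define r where "r = (e - 1 / real (Suc j)) / 2"
    have r: "r > 0" using e by (simp add: r_def)
    have "r \<le> (e - 1 / real (Suc j)) / 2" by (simp add: r_def)
    then have r': "e - r > 1 / real (Suc j)" using e by argo
    show "\<exists>r>0. \<forall>y\<in>?C. (\<forall>t\<in>{0..T}. \<bar>x t - y t\<bar> \<le> r) \<longrightarrow> y \<in> V j"
    proof (intro exI[of _ r] conjI ballI impI r)
      fix y assume y: "y \<in> ?C" "\<forall>t\<in>{0..T}. \<bar>x t - y t\<bar> \<le> r"
      have "z \<in> U" if z: "z \<in> ?C" "\<forall>t\<in>{0..T}. \<bar>y t - z t\<bar> \<le> e - r" for z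
      proof (rule *[OF z(1)], rule ballI)
        fix t assume "t \<in> {0..T}"
        then have "\<bar>x t - y t\<bar> \<le> r" "\<bar>y t - z t\<bar> \<le> e - r" using y z by auto
        then show "\<bar>x t - z t\<bar> \<le> e" by linarith
      qed
      then show "y \<in> V j" unfolding V_def using y(1) r' by blast
    qed
  qed
  have [measurable]: "V j \<in> sets (C_borel T)" for j
    using V by (auto simp: sets_C_borel)
  have YC: "Y n \<omega> \<in> ?C" if "\<omega> \<in> space N" for n \<omega>
    using measurable_space[OF Y that] by simp
  have *: "Z \<omega> \<in> U \<longleftrightarrow> (\<exists>j k. \<forall>n\<ge>k. Y n \<omega> \<in> V j)" if \<omega>: "\<omega> \<in> space N" for \<omega>
  proof
    assume "Z \<omega> \<in> U"
    then obtain r where r: "r > 0" "\<And>y. y \<in> ?C \<Longrightarrow> (\<forall>t\<in>{0..T}. \<bar>Z \<omega> t - y t\<bar> \<le> r) \<Longrightarrow> y \<in> U"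
      using U openin_C_metric_iff[OF assms(1)] by metis
    obtain j where j: "1 / real (Suc j) < r / 2"
      using nat_approx_posE[of "r / 2"] r(1) by auto
    have "\<forall>\<^sub>F n in sequentially. \<forall>t\<in>{0..T}. dist (Y n \<omega> t) (Z \<omega> t) < r / 2"
      using uniform_limitD[OF lim[OF \<omega>], of "r / 2"] r(1) by simp
    then have "\<forall>\<^sub>F n in sequentially. Y n \<omega> \<in> V j"
    proof eventually_elim
      case (elim n)
      have "y \<in> U" if y: "y \<in> ?C" "\<forall>t\<in>{0..T}. \<bar>Y n \<omega> t - y t\<bar> \<le> r / 2" for y
      proof (rule r(2)[OF y(1)], rule ballI)
        fix t assume "t \<in> {0..T}"
        then have "\<bar>Y n \<omega> t - Z \<omega> t\<bar> < r / 2" "\<bar>Y n \<omega> t - y t\<bar> \<le> r / 2"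
          using y elim by (auto simp: dist_real_def)
        then show "\<bar>Z \<omega> t - y t\<bar> \<le> r" by linarith
      qed
      then show ?case unfolding V_def using YC[OF \<omega>] j by blast
    qed
    then show "\<exists>j k. \<forall>n\<ge>k. Y n \<omega> \<in> V j" by (auto simp: eventually_sequentially)
  next
    assume "\<exists>j k. \<forall>n\<ge>k. Y n \<omega> \<in> V j"
    then obtain j k where jk: "\<And>n. n \<ge> k \<Longrightarrow> Y n \<omega> \<in> V j" by blast
    have "\<forall>\<^sub>F n in sequentially. (\<forall>t\<in>{0..T}. dist (Y n \<omega> t) (Z \<omega> t) < 1 / real (Suc j)) \<and> n \<ge> k"
      using uniform_limitD[OF lim[OF \<omega>], of "1 / real (Suc j)"] eventually_ge_at_top[of k]
      by (intro eventually_conj) auto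
    then obtain n where n: "\<forall>t\<in>{0..T}. dist (Y n \<omega> t) (Z \<omega> t) < 1 / real (Suc j)" "n \<ge> k"
      using eventually_happens'[OF sequentially_bot] by blast
    then obtain e where e: "e > 1 / real (Suc j)"
      "\<And>y. y \<in> ?C \<Longrightarrow> (\<forall>t\<in>{0..T}. \<bar>Y n \<omega> t - y t\<bar> \<le> e) \<Longrightarrow> y \<in> U"
      using jk[of n] by (auto simp: V_def)
    have "\<bar>Y n \<omega> t - Z \<omega> t\<bar> \<le> e" if "t \<in> {0..T}" for t
      using less_trans[OF bspec[OF n(1) that] e(1)] by (simp add: dist_real_def)
    then show "Z \<omega> \<in> U" using e(2)[OF Z[OF \<omega>]] by blast
  qed
  have "Z -` U \<inter> space N = {\<omega> \<in> space N. \<exists>j k. \<forall>n\<ge>k. Y n \<omega> \<in> V j}"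
    using * by auto
  also have "\<dots> \<in> sets N"
    using Y by measurable
  finally show "Z -` U \<inter> space N \<in> sets N" .
qed (use Z in auto)

section \<open>Finite combinations of fixed continuous functions\<close>

definition lin_comb :: "real \<Rightarrow> nat \<Rightarrow> (nat \<Rightarrow> real \<Rightarrow> real) \<Rightarrow> (nat \<Rightarrow> real) \<Rightarrow> real \<Rightarrow> real" where
  "lin_comb T m e z = restrict (\<lambda>t. \<Sum>l<m. z l * e l t) {0..T}"

lemma lin_comb_in_mspace:
  assumes "\<And>l. l < m \<Longrightarrow> continuous_on {0..T} (e l)"
  shows "lin_comb T m e z \<in> mspace (C_metric T)"
proof -
  have "continuous_on {0..T} (\<lambda>t. \<Sum>l<m. z l * e l t)"
    using assms by (intro continuous_intros) auto
  then have "continuous_on {0..T} (lin_comb T m e z)"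
    by (rule continuous_on_eq) (simp add: lin_comb_def)
  then show ?thesis
    by (simp add: mspace_C_metric lin_comb_def)
qed

text \<open>The path depends continuously on its coefficients. The lemma is used twice: with the
  Bernstein functions, and with the functions that multiply independent Brownian increments.\<close>

lemma measurable_lin_comb:
  assumes "0 \<le> T" and e: "\<And>l. l < m \<Longrightarrow> continuous_on {0..T} (e l)"
  shows "lin_comb T m e \<in> measurable (Pi\<^sub>M {..<m} (\<lambda>_. borel)) (C_borel T)"
proof (rule measurable_C_borelI)
  fix U assume U: "openin (mtopology_of (C_metric T)) U"
  have bd: "\<exists>B. \<forall>t\<in>{0..T}. \<bar>e l t\<bar> \<le> B" if "l < m" for l
    using compact_imp_bounded[OF compact_continuous_image[OF e[OF that]]] compact_Icc
    by (auto simp: bounded_iff)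
  then obtain B where B: "\<And>l t. l < m \<Longrightarrow> t \<in> {0..T} \<Longrightarrow> \<bar>e l t\<bar> \<le> B l" by metis
  \<comment> \<open>Changing every coefficient by at most \<open>r / K\<close> moves the path by at
    most \<open>r\<close> everywhere; the summand 1 keeps \<open>K\<close> positive even if
    \<open>m = 0\<close>.\<close>
  define K where "K = 1 + (\<Sum>l<m. \<bar>B l\<bar>)"
  have K: "K > 0" unfolding K_def by (smt (verit) sum_nonneg abs_ge_zero)
  define S where "S = {z. lin_comb T m e z \<in> U}"
  have "open S"
  proof (subst open_subopen, rule ballI)
    fix z assume "z \<in> S"
    then have "lin_comb T m e z \<in> U" by (simp add: S_def)
    then obtain r where r: "r > 0"
      "\<And>y. y \<in> mspace (C_metric T) \<Longrightarrow> (\<forall>t\<in>{0..T}. \<bar>lin_comb T m e z t - y t\<bar> \<le> r) \<Longrightarrow> y \<in> U"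
      using U openin_C_metric_iff[OF assms(1)] by metis
    define Q where "Q = (\<Inter>l\<in>{..<m}. (\<lambda>w::nat \<Rightarrow> real. w l) -` ball (z l) (r / K))"
    have "open Q" unfolding Q_def
      by (intro open_INT ballI open_vimage continuous_on_product_coordinates) auto
    moreover have "z \<in> Q" using r K by (auto simp: Q_def)
    moreover have "Q \<subseteq> S"
    proof
      fix w assume w: "w \<in> Q"
      have "lin_comb T m e w \<in> U"
      proof (rule r(2)[OF lin_comb_in_mspace[OF e]], assumption, rule ballI)
        fix t assume t: "t \<in> {0..T}"
        have "\<bar>lin_comb T m e z t - lin_comb T m e w t\<bar> = \<bar>\<Sum>l<m. (z l - w l) * e l t\<bar>"
          using t by (simp add: lin_comb_def sum_subtractf left_diff_distrib)
        also have "\<dots> \<le> (\<Sum>l<m. \<bar>z l - w l\<bar> * \<bar>e l t\<bar>)"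
          by (rule order_trans[OF sum_abs]) (simp add: abs_mult)
        also have "\<dots> \<le> (\<Sum>l<m. r / K * \<bar>B l\<bar>)"
        proof (intro sum_mono mult_mono)
          fix l assume "l \<in> {..<m}"
          then show "\<bar>z l - w l\<bar> \<le> r / K" "\<bar>e l t\<bar> \<le> \<bar>B l\<bar>"
            using w B[of l t] t by (auto simp: Q_def dist_real_def intro: less_imp_le)
        qed (use r K in auto)
        also have "\<dots> = r * ((\<Sum>l<m. \<bar>B l\<bar>) / K)"
          by (simp add: sum_distrib_left sum_divide_distrib)
        also have "\<dots> \<le> r * 1"
          using r K by (intro mult_left_mono) (auto simp: K_def)
        finally show "\<bar>lin_comb T m e z t - lin_comb T m e w t\<bar> \<le> r" by simp
      qed
      then show "w \<in> S" by (simp add: S_def)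
    qed
    ultimately show "\<exists>T. open T \<and> z \<in> T \<and> T \<subseteq> S" by blast
  qed
  then have S: "S \<in> sets (Pi\<^sub>M UNIV (\<lambda>_. borel))" by (simp add: sets_PiM_equal_borel)
  \<comment> \<open>\<open>S\<close> is open in the product over all of \<open>nat\<close>, where
    the product and Borel fields agree. Filling the missing coordinates with 0 pulls it back to the
    product over \<open>{..<m}\<close>, and \<open>lin_comb\<close> does not see the
    difference.\<close>
  define p where "p z = (\<lambda>l. if l < m then z l else 0)" for z :: "nat \<Rightarrow> real"
  have p: "p \<in> measurable (Pi\<^sub>M {..<m} (\<lambda>_. borel)) (Pi\<^sub>M UNIV (\<lambda>_. borel))"
    unfolding p_def
  proof (rule measurable_PiM_single')
    fix l :: nat assume "l \<in> UNIV"
    show "(\<lambda>z. if l < m then z l else 0) \<in> borel_measurable (Pi\<^sub>M {..<m} (\<lambda>_. borel))"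
      by (cases "l < m") auto
  qed auto
  have "lin_comb T m e (p z) = lin_comb T m e z" for z
    by (auto simp: lin_comb_def p_def intro!: restrict_ext sum.cong)
  then have "lin_comb T m e -` U \<inter> space (Pi\<^sub>M {..<m} (\<lambda>_. borel)) =
      p -` S \<inter> space (Pi\<^sub>M {..<m} (\<lambda>_. borel))"
    by (auto simp: S_def)
  with measurable_sets[OF p S]
  show "lin_comb T m e -` U \<inter> space (Pi\<^sub>M {..<m} (\<lambda>_. borel)) \<in> sets (Pi\<^sub>M {..<m} (\<lambda>_. borel))"
    by simp
qed (rule lin_comb_in_mspace[OF e])


section \<open>Harris' inequality\<close>

text \<open>For two nondecreasing functions the product \<open>(g x - g y) * (h x - h y)\<close> is
  never negative, and its integral over two independent copies of the variable is twice the
  covariance.\<close>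

lemma chebyshev_association:
  fixes M :: "real measure" and g h :: "real \<Rightarrow> real"
  assumes "prob_space M" and [simp]: "sets M = sets borel"
    and [measurable]: "g \<in> borel_measurable borel" "h \<in> borel_measurable borel"
    and bd: "\<And>x. \<bar>g x\<bar> \<le> B" "\<And>x. \<bar>h x\<bar> \<le> B"
    and mono: "mono g" "mono h"
  shows "(\<integral>x. g x \<partial>M) * (\<integral>x. h x \<partial>M) \<le> (\<integral>x. g x * h x \<partial>M)"
proof -
  interpret prob_space M by fact
  have [measurable]: "g \<in> borel_measurable M" "h \<in> borel_measurable M"
    by (simp_all cong: measurable_cong_sets)
  have ig: "integrable M g" and ih: "integrable M h"
    using bd by (auto intro!: integrable_const_bound[where B = B])
  have igh: "integrable M (\<lambda>x. g x * h x)"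
    using bd by (intro integrable_const_bound[where B = "B * B"])
      (auto simp: abs_mult intro!: mult_mono order_trans[OF abs_ge_zero])
  have "0 \<le> (\<integral>x. (\<integral>y. (g x - g y) * (h x - h y) \<partial>M) \<partial>M)"
  proof (intro Bochner_Integration.integral_nonneg)
    fix x y
    show "0 \<le> (g x - g y) * (h x - h y)"
      using monoD[OF mono(1)] monoD[OF mono(2)] linear[of x y]
      by (auto simp: zero_le_mult_iff)
  qed
  also have "(\<lambda>x. (\<integral>y. (g x - g y) * (h x - h y) \<partial>M)) =
      (\<lambda>x. g x * h x - g x * expectation h - h x * expectation g + (\<integral>y. g y * h y \<partial>M))"
  proof
    fix x
    have "(\<integral>y. (g x - g y) * (h x - h y) \<partial>M) =
        (\<integral>y. g x * h x - g x * h y - h x * g y + g y * h y \<partial>M)"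
      by (intro Bochner_Integration.integral_cong) (auto simp: algebra_simps)
    also have "\<dots> = g x * h x - g x * expectation h - h x * expectation g + (\<integral>y. g y * h y \<partial>M)"
      using ig ih igh by (simp add: prob_space)
    finally show "(\<integral>y. (g x - g y) * (h x - h y) \<partial>M) = \<dots>" .
  qed
  also have "integral\<^sup>L M \<dots> = 2 * (\<integral>x. g x * h x \<partial>M) - 2 * (expectation g * expectation h)"
    using ig ih igh by (simp add: prob_space)
  finally show ?thesis by simp
qed

text \<open>Induction on the coordinates: averaging over the new coordinate \<open>i\<close>
  preserves measurability, bounds and monotonicity, so the induction hypothesis applies to the
  averages \<open>\<Phi>'\<close> and \<open>\<Psi>'\<close>. Hypotheses are restricted to
  \<open>extensional I\<close> because this is the space of the product measure.\<close>

lemma harris_inequality: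
  fixes \<mu> :: "'i \<Rightarrow> real measure" and \<Phi> \<Psi> :: "('i \<Rightarrow> real) \<Rightarrow> real"
  assumes "finite I"
    and \<mu>: "\<And>i. prob_space (\<mu> i)" "\<And>i. sets (\<mu> i) = sets borel"
    and "\<Phi> \<in> borel_measurable (Pi\<^sub>M I \<mu>)" "\<Psi> \<in> borel_measurable (Pi\<^sub>M I \<mu>)"
    and "\<And>x. x \<in> extensional I \<Longrightarrow> \<bar>\<Phi> x\<bar> \<le> B" "\<And>x. x \<in> extensional I \<Longrightarrow> \<bar>\<Psi> x\<bar> \<le> B"
    and "\<And>x y. x \<in> extensional I \<Longrightarrow> y \<in> extensional I \<Longrightarrow> (\<And>i. i \<in> I \<Longrightarrow> x i \<le> y i) \<Longrightarrow> \<Phi> x \<le> \<Phi> y"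
    and "\<And>x y. x \<in> extensional I \<Longrightarrow> y \<in> extensional I \<Longrightarrow> (\<And>i. i \<in> I \<Longrightarrow> x i \<le> y i) \<Longrightarrow> \<Psi> x \<le> \<Psi> y"
  shows "(\<integral>x. \<Phi> x \<partial>Pi\<^sub>M I \<mu>) * (\<integral>x. \<Psi> x \<partial>Pi\<^sub>M I \<mu>) \<le> (\<integral>x. \<Phi> x * \<Psi> x \<partial>Pi\<^sub>M I \<mu>)"
  using assms(1,4-)
proof (induction I arbitrary: \<Phi> \<Psi> rule: finite_induct)
  case empty
  show ?case by (simp add: PiM_empty lebesgue_integral_count_space_finite)
next
  case (insert i I)
  interpret i: prob_space "\<mu> i" by (rule \<mu>)
  interpret J: prob_space "Pi\<^sub>M (insert i I) \<mu>" by (rule prob_space_PiM) (rule \<mu>)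
  interpret I: prob_space "Pi\<^sub>M I \<mu>" by (rule prob_space_PiM) (rule \<mu>)
  interpret product_prob_space \<mu> I
    using \<mu>(1) by (rule product_prob_spaceI)
  note [measurable] = insert.prems(1,2)
  have sp: "space (\<mu> j) = UNIV" for j using sets_eq_imp_space_eq[OF \<mu>(2)] by simp
  have spI: "space (Pi\<^sub>M J \<mu>) = extensional J" for J by (simp add: space_PiM sp PiE_UNIV_domain PiE_def)
  have ext: "x(i := y) \<in> extensional (insert i I)" if "x \<in> extensional I" for x y
    using that by (auto simp: extensional_def)
  \<comment> \<open>The constantly undefined function is extensional on every set, so the bound can
    be evaluated there to give a sign for \<open>B\<close>.\<close>
  have B0: "0 \<le> B" using insert.prems(3)[of "\<lambda>_. undefined"] by (auto simp: extensional_def)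
  have slice: "(\<lambda>y. \<Theta> (x(i := y))) \<in> borel_measurable (\<mu> i)"
    if [measurable]: "\<Theta> \<in> borel_measurable (Pi\<^sub>M (insert i I) \<mu>)" and x: "x \<in> extensional I"
    for \<Theta> :: "('i \<Rightarrow> real) \<Rightarrow> real" and x
    using x by (intro measurable_compose[OF measurable_component_update that(1)])
      (auto simp: spI insert)
  have ints: "integrable (\<mu> i) (\<lambda>y. \<Theta> (x(i := y)))"
    if "\<Theta> \<in> borel_measurable (Pi\<^sub>M (insert i I) \<mu>)" "x \<in> extensional I"
      "\<And>x. x \<in> extensional (insert i I) \<Longrightarrow> \<bar>\<Theta> x\<bar> \<le> b"
    for \<Theta> :: "('i \<Rightarrow> real) \<Rightarrow> real" and x b
    using that ext by (intro i.integrable_const_bound[where B = b] slice) auto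
  have bdp: "\<bar>\<Phi> x * \<Psi> x\<bar> \<le> B * B" if "x \<in> extensional (insert i I)" for x
    unfolding abs_mult using insert.prems(3,4)[OF that] B0 by (intro mult_mono) auto
  define \<Phi>' where "\<Phi>' x = (\<integral>y. \<Phi> (x(i := y)) \<partial>\<mu> i)" for x
  define \<Psi>' where "\<Psi>' x = (\<integral>y. \<Psi> (x(i := y)) \<partial>\<mu> i)" for x
  have [measurable]: "\<Phi>' \<in> borel_measurable (Pi\<^sub>M I \<mu>)" "\<Psi>' \<in> borel_measurable (Pi\<^sub>M I \<mu>)"
    unfolding \<Phi>'_def \<Psi>'_def by measurable
  have bd': "\<bar>\<integral>y. \<Theta> (x(i := y)) \<partial>\<mu> i\<bar> \<le> b"
    if "x \<in> extensional I" "\<Theta> \<in> borel_measurable (Pi\<^sub>M (insert i I) \<mu>)"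
      "\<And>x. x \<in> extensional (insert i I) \<Longrightarrow> \<bar>\<Theta> x\<bar> \<le> b"
    for x b and \<Theta> :: "('i \<Rightarrow> real) \<Rightarrow> real"
  proof -
    have "\<bar>\<integral>y. \<Theta> (x(i := y)) \<partial>\<mu> i\<bar> \<le> (\<integral>y. \<bar>\<Theta> (x(i := y))\<bar> \<partial>\<mu> i)"
      by (rule integral_abs_bound)
    also have "\<dots> \<le> (\<integral>y. b \<partial>\<mu> i)"
      using that ext by (intro integral_mono) (auto intro!: ints)
    finally show ?thesis by (simp add: i.prob_space)
  qed
  have "(\<integral>x. \<Phi> x \<partial>Pi\<^sub>M (insert i I) \<mu>) * (\<integral>x. \<Psi> x \<partial>Pi\<^sub>M (insert i I) \<mu>)
      = (\<integral>x. \<Phi>' x \<partial>Pi\<^sub>M I \<mu>) * (\<integral>x. \<Psi>' x \<partial>Pi\<^sub>M I \<mu>)"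
    unfolding \<Phi>'_def \<Psi>'_def
    using insert.prems insert.hyps
    by (subst (1 2) product_integral_insert)
      (auto intro!: J.integrable_const_bound[where B = B] simp: spI)
  also have "\<dots> \<le> (\<integral>x. \<Phi>' x * \<Psi>' x \<partial>Pi\<^sub>M I \<mu>)"
  proof (rule insert.IH)
    fix x y :: "'i \<Rightarrow> real" assume xy: "x \<in> extensional I" "y \<in> extensional I" "\<And>i. i \<in> I \<Longrightarrow> x i \<le> y i"
    have le: "(x(i := z)) j \<le> (y(i := z)) j" if "j \<in> insert i I" for j z using xy that by auto
    show "\<Phi>' x \<le> \<Phi>' y" unfolding \<Phi>'_def
      using xy insert.prems le by (intro integral_mono ints insert.prems(5) ext) auto
    show "\<Psi>' x \<le> \<Psi>' y" unfolding \<Psi>'_def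
      using xy insert.prems le by (intro integral_mono ints insert.prems(6) ext) auto
  next
    fix x :: "'i \<Rightarrow> real" assume "x \<in> extensional I"
    then show "\<bar>\<Phi>' x\<bar> \<le> B" "\<bar>\<Psi>' x\<bar> \<le> B" unfolding \<Phi>'_def \<Psi>'_def
      using insert.prems by (auto intro!: bd')
  qed auto
  \<comment> \<open>With the other coordinates frozen, both functions are monotone in coordinate
    \<open>i\<close>, and the one-dimensional inequality compares the product of the averages with
    the average of the product.\<close>
  also have "\<dots> \<le> (\<integral>x. (\<integral>y. \<Phi> (x(i := y)) * \<Psi> (x(i := y)) \<partial>\<mu> i) \<partial>Pi\<^sub>M I \<mu>)"
  proof (rule integral_mono)
    fix x assume "x \<in> space (Pi\<^sub>M I \<mu>)"
    then have x: "x \<in> extensional I" by (simp add: spI)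
    have "mono (\<lambda>y. \<Phi> (x(i := y)))" "mono (\<lambda>y. \<Psi> (x(i := y)))"
      using insert.hyps by (auto intro!: monoI insert.prems(5,6) ext x)
    moreover have "(\<lambda>y. \<Phi> (x(i := y))) \<in> borel_measurable borel"
      "(\<lambda>y. \<Psi> (x(i := y))) \<in> borel_measurable borel"
      using slice[OF insert.prems(1) x] slice[OF insert.prems(2) x]
      unfolding measurable_cong_sets[OF \<mu>(2) refl] .
    ultimately show "\<Phi>' x * \<Psi>' x \<le> (\<integral>y. \<Phi> (x(i := y)) * \<Psi> (x(i := y)) \<partial>\<mu> i)"
      unfolding \<Phi>'_def \<Psi>'_def
      by (intro chebyshev_association[where B = B] \<mu> insert.prems(3,4) ext x)
  next
    have "\<bar>\<Phi>' x * \<Psi>' x\<bar> \<le> B * B" if "x \<in> extensional I" for x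
      unfolding abs_mult \<Phi>'_def \<Psi>'_def using that insert.prems B0 by (intro mult_mono bd') auto
    then show "integrable (Pi\<^sub>M I \<mu>) (\<lambda>x. \<Phi>' x * \<Psi>' x)"
      by (intro I.integrable_const_bound[where B = "B * B"]) (auto simp: spI)
    show "integrable (Pi\<^sub>M I \<mu>) (\<lambda>x. \<integral>y. \<Phi> (x(i := y)) * \<Psi> (x(i := y)) \<partial>\<mu> i)"
      using bdp by (intro I.integrable_const_bound[where B = "B * B"])
        (auto simp: spI intro!: bd'[of _ "\<lambda>x. \<Phi> x * \<Psi> x"])
  qed
  also have "\<dots> = (\<integral>x. \<Phi> x * \<Psi> x \<partial>Pi\<^sub>M (insert i I) \<mu>)"
    using insert.hyps bdp
    by (subst product_integral_insert)
      (auto intro!: J.integrable_const_bound[where B = "B * B"] simp: spI)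
  finally show ?case .
qed

text \<open>Independence says that the joint law is the product of the marginals, so both sides are
  integrals against a product measure.\<close>

lemma (in prob_space) indep_vars_harris_inequality:
  fixes Z :: "'i \<Rightarrow> 'a \<Rightarrow> real" and \<Phi> \<Psi> :: "('i \<Rightarrow> real) \<Rightarrow> real"
  assumes "finite I" and indep: "indep_vars (\<lambda>_. borel) Z I"
    and [measurable]: "\<Phi> \<in> borel_measurable (Pi\<^sub>M I (\<lambda>_. borel))"
      "\<Psi> \<in> borel_measurable (Pi\<^sub>M I (\<lambda>_. borel))"
    and bd: "\<And>x. \<bar>\<Phi> x\<bar> \<le> B" "\<And>x. \<bar>\<Psi> x\<bar> \<le> B"
    and mono: "\<And>x y. (\<And>i. i \<in> I \<Longrightarrow> x i \<le> y i) \<Longrightarrow> \<Phi> x \<le> \<Phi> y"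
      "\<And>x y. (\<And>i. i \<in> I \<Longrightarrow> x i \<le> y i) \<Longrightarrow> \<Psi> x \<le> \<Psi> y"
  shows "expectation (\<lambda>\<omega>. \<Phi> (\<lambda>i\<in>I. Z i \<omega>)) * expectation (\<lambda>\<omega>. \<Psi> (\<lambda>i\<in>I. Z i \<omega>))
    \<le> expectation (\<lambda>\<omega>. \<Phi> (\<lambda>i\<in>I. Z i \<omega>) * \<Psi> (\<lambda>i\<in>I. Z i \<omega>))"
\<comment> \<open>The characterization of independence by the joint law is applied only to a
  nonempty index set; for no variables both functions are constant.\<close>
proof (cases "I = {}")
  case True then show ?thesis by (simp add: restrict_def prob_space)
next
  case False
  have Z[measurable]: "Z i \<in> borel_measurable M" if "i \<in> I" for i
    using indep that by (auto simp: indep_vars_def)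
  \<comment> \<open>The product argument wants a probability measure at every index; the point mass
    at 0 is a dummy outside \<open>I\<close>.\<close>
  define \<mu> where "\<mu> i = (if i \<in> I then distr M borel (Z i) else return borel 0)" for i
  have \<mu>: "prob_space (\<mu> i)" "sets (\<mu> i) = sets borel" for i
    by (auto simp: \<mu>_def prob_space_distr prob_space_return)
  have sets: "sets (Pi\<^sub>M I \<mu>) = sets (Pi\<^sub>M I (\<lambda>_. borel))"
    by (intro sets_PiM_cong) (auto simp: \<mu>)
  have [measurable]: "(\<lambda>\<omega>. \<lambda>i\<in>I. Z i \<omega>) \<in> measurable M (Pi\<^sub>M I (\<lambda>_. borel))"
    by (intro measurable_restrict) auto
  have d: "distr M (Pi\<^sub>M I (\<lambda>_. borel)) (\<lambda>\<omega>. \<lambda>i\<in>I. Z i \<omega>) = Pi\<^sub>M I \<mu>"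
    using indep_vars_iff_distr_eq_PiM'[OF False, of Z "\<lambda>_. borel"] indep Z
    by (auto simp: \<mu>_def cong: PiM_cong)
  have eq: "expectation (\<lambda>\<omega>. h (\<lambda>i\<in>I. Z i \<omega>)) = (\<integral>x. h x \<partial>Pi\<^sub>M I \<mu>)"
    if [measurable]: "h \<in> borel_measurable (Pi\<^sub>M I (\<lambda>_. borel))" for h :: "('i \<Rightarrow> real) \<Rightarrow> real"
    unfolding d[symmetric] by (rule integral_distr[symmetric]) measurable
  have "(\<integral>x. \<Phi> x \<partial>Pi\<^sub>M I \<mu>) * (\<integral>x. \<Psi> x \<partial>Pi\<^sub>M I \<mu>) \<le> (\<integral>x. \<Phi> x * \<Psi> x \<partial>Pi\<^sub>M I \<mu>)"
    using assms sets by (intro harris_inequality[where B = B] \<mu>) (auto cong: measurable_cong_sets)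
  then show ?thesis
    using eq[OF assms(3)] eq[OF assms(4)] eq[of "\<lambda>x. \<Phi> x * \<Psi> x"] by simp
qed


section \<open>Step integrals\<close>

lemma step_nodes_mono:
  assumes "step_nodes t n u" "i \<le> j" "j \<le> n"
  shows "u i \<le> u j"
  using assms(2,3)
proof (induction rule: dec_induct)
  case (step k)
  moreover have "u k \<le> u (Suc k)" using assms(1) step by (simp add: step_nodes_def)
  ultimately show ?case by linarith
qed simp

text \<open>The intervals of a subdivision are disjoint. The index \<open>i\<close> is chosen before
  the coefficients, so step functions with the same nodes but different coefficients can be compared
  at the same point.\<close>

lemma step_fun_cases:
  assumes "step_nodes t n u"
  obtains "\<And>c. step_fun n u c s = 0" | i where "i < n" "\<And>c. step_fun n u c s = c i"
proof (cases "\<exists>i<n. s \<in> {u i<..u (Suc i)}")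
  case False
  then have "step_fun n u c s = 0" for c
    unfolding step_fun_def by (intro sum.neutral) (auto simp: indicator_def)
  then show ?thesis by (rule that(1))
next
  case True
  then obtain i where i: "i < n" "s \<in> {u i<..u (Suc i)}" by blast
  have "s \<notin> {u j<..u (Suc j)}" if "j < n" "j \<noteq> i" for j
  proof (cases "j < i")
    case True
    then have "u (Suc j) \<le> u i" using i by (intro step_nodes_mono[OF assms]) auto
    then show ?thesis using i by auto
  next
    case False
    then have "u (Suc i) \<le> u j" using that by (intro step_nodes_mono[OF assms]) auto
    then show ?thesis using i by auto
  qed
  then have "step_fun n u c s = (\<Sum>j<n. if j = i then c i else 0)" for c
    unfolding step_fun_def using i by (intro sum.cong) (auto simp: indicator_def)
  then show ?thesis using i by (intro that(2)[of i]) auto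
qed

text \<open>The deterministic half of the isometry: disjoint intervals leave no cross terms. The
  matching sum for the stochastic side is in \<open>nn_integral_step_integral_sq\<close>.\<close>

lemma nn_integral_step_fun_sq:
  assumes "step_nodes t n u"
  shows "(\<integral>\<^sup>+ s. ennreal ((step_fun n u c s)\<^sup>2) \<partial>lebesgue_on {0..t}) =
    ennreal (\<Sum>i<n. (c i)\<^sup>2 * (u (Suc i) - u i))"
proof -
  have u: "0 \<le> u i" "u i \<le> t" "u i \<le> u (Suc i)" "u (Suc i) \<le> t" if "i < n" for i
    using assms that by (auto simp: step_nodes_def Suc_le_eq)
  have meas: "{u i<..u (Suc i)} \<subseteq> {0..t}" if "i < n" for i
    using u[OF that] by auto
  have sq: "(step_fun n u c s)\<^sup>2 = (\<Sum>i<n. (c i)\<^sup>2 * indicator {u i<..u (Suc i)} s)" for s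
  proof -
    have "(step_fun n u c s)\<^sup>2 = step_fun n u (\<lambda>i. (c i)\<^sup>2) s"
      by (rule step_fun_cases[OF assms, of s]) simp_all
    then show ?thesis by (simp add: step_fun_def)
  qed
  have "(\<integral>\<^sup>+ s. ennreal ((step_fun n u c s)\<^sup>2) \<partial>lebesgue_on {0..t}) =
      (\<integral>\<^sup>+ s. (\<Sum>i<n. ennreal ((c i)\<^sup>2) * indicator {u i<..u (Suc i)} s) \<partial>lebesgue_on {0..t})"
    unfolding sq
    by (subst sum_ennreal[symmetric]) (auto intro!: nn_integral_cong sum.cong split: split_indicator)
  also have "\<dots> = (\<Sum>i<n. ennreal ((c i)\<^sup>2) * emeasure (lebesgue_on {0..t}) {u i<..u (Suc i)})"
    using u meas by (subst nn_integral_sum)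
      (auto simp del: greaterThanAtMost_iff simp: sets_restrict_space_iff
        intro!: sum.cong nn_integral_cmult_indicator borel_measurable_times_ennreal
          borel_measurable_indicator)
  also have "\<dots> = (\<Sum>i<n. ennreal ((c i)\<^sup>2 * (u (Suc i) - u i)))"
  proof (intro sum.cong refl)
    fix i assume i: "i \<in> {..<n}"
    then have "emeasure (lebesgue_on {0..t}) {u i<..u (Suc i)} = ennreal (u (Suc i) - u i)"
      using u[of i] by (subst emeasure_restrict_space) auto
    then show "ennreal ((c i)\<^sup>2) * emeasure (lebesgue_on {0..t}) {u i<..u (Suc i)} =
        ennreal ((c i)\<^sup>2 * (u (Suc i) - u i))"
      using u[of i] i by (simp add: ennreal_mult)
  qed
  also have "\<dots> = ennreal (\<Sum>i<n. (c i)\<^sup>2 * (u (Suc i) - u i))"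
    using u by (intro sum_ennreal) auto
  finally show ?thesis .
qed

lemma bm_increment_moments:
  assumes "standard_brownian_motion M T W" "0 \<le> s" "s \<le> t" "t \<le> T"
  shows "integrable M (\<lambda>\<omega>. W t \<omega> - W s \<omega>)"
    and "(\<integral>\<omega>. W t \<omega> - W s \<omega> \<partial>M) = 0"
    and "integrable M (\<lambda>\<omega>. (W t \<omega> - W s \<omega>)\<^sup>2)"
    and "(\<integral>\<omega>. (W t \<omega> - W s \<omega>)\<^sup>2 \<partial>M) = t - s"
proof -
  interpret prob_space M using assms(1) by (simp add: standard_brownian_motion_def)
  let ?Z = "\<lambda>\<omega>. W t \<omega> - W s \<omega>"
  have "integrable M ?Z \<and> expectation ?Z = 0 \<and> integrable M (\<lambda>\<omega>. (?Z \<omega>)\<^sup>2)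
      \<and> expectation (\<lambda>\<omega>. (?Z \<omega>)\<^sup>2) = t - s"
  \<comment> \<open>Nodes may repeat, while the normal law is prescribed only for
    \<open>s < t\<close>; for equal times the increment vanishes identically.\<close>
  proof (cases "s = t")
    case False
    then have s: "s < t" and pos: "0 < sqrt (t - s)" using assms by auto
    have D: "distributed M lborel ?Z (normal_density 0 (sqrt (t - s)))"
      using assms s by (simp add: standard_brownian_motion_def)
    have int: "integrable M (\<lambda>\<omega>. ?Z \<omega> ^ k)" for k
      using distributed_integrable[OF D, of "\<lambda>x. x ^ k"] integrable_normal_moment[OF pos, of 0 k]
      by simp
    have E: "expectation ?Z = 0" by (rule normal_distributed_expectation[OF pos D])
    have "variance ?Z = (sqrt (t - s))\<^sup>2" by (rule normal_distributed_variance[OF pos D])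
    then have "expectation (\<lambda>\<omega>. (?Z \<omega>)\<^sup>2) = t - s" using E s by simp
    then show ?thesis using int[of 1] int[of 2] E by simp
  qed simp
  then show "integrable M ?Z" "expectation ?Z = 0" "integrable M (\<lambda>\<omega>. (?Z \<omega>)\<^sup>2)"
    "expectation (\<lambda>\<omega>. (?Z \<omega>)\<^sup>2) = t - s" by auto
qed

lemma borel_measurable_step_integral:
  assumes "standard_brownian_motion M T W" "step_nodes t n u" "t \<le> T"
  shows "step_integral W n u c \<in> borel_measurable M"
proof -
  have [measurable]: "W (u i) \<in> borel_measurable M" if "i \<le> n" for i
    using assms that by (auto simp: standard_brownian_motion_def step_nodes_def)
  show ?thesis unfolding step_integral_def by measurable
qed

lemma bm_indep_increments:
  assumes "standard_brownian_motion M T W" "step_nodes T n u"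
  shows "prob_space.indep_vars M (\<lambda>_. borel) (\<lambda>i \<omega>. W (u (Suc i)) \<omega> - W (u i) \<omega>) {..<n}"
  using assms unfolding standard_brownian_motion_def step_nodes_def by blast

lemma step_nodes_le: "step_nodes t n u \<Longrightarrow> t \<le> T \<Longrightarrow> step_nodes T n u"
  unfolding step_nodes_def by (meson atLeastAtMost_iff order_trans)

text \<open>Increments over successive intervals are independent and centred, hence orthogonal, so
  only the diagonal terms survive.\<close>

lemma nn_integral_step_integral_sq:
  assumes bm: "standard_brownian_motion M T W" and "step_nodes t n u" "t \<le> T"
  shows "(\<integral>\<^sup>+ \<omega>. ennreal ((step_integral W n u c \<omega>)\<^sup>2) \<partial>M) =
    ennreal (\<Sum>i<n. (c i)\<^sup>2 * (u (Suc i) - u i))"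
proof -
  interpret prob_space M using bm by (simp add: standard_brownian_motion_def)
  let ?Z = "\<lambda>i \<omega>. W (u (Suc i)) \<omega> - W (u i) \<omega>"
  have u: "0 \<le> u i" "u i \<le> u (Suc i)" "u (Suc i) \<le> T" if "i < n" for i
    using step_nodes_le[OF assms(2,3)] that by (auto simp: step_nodes_def Suc_le_eq)
  note mom = bm_increment_moments[OF bm u]
  have cov: "integrable M (\<lambda>\<omega>. ?Z i \<omega> * ?Z j \<omega>) \<and>
      expectation (\<lambda>\<omega>. ?Z i \<omega> * ?Z j \<omega>) = (if i = j then u (Suc i) - u i else 0)"
    if ij: "i < n" "j < n" for i j
  proof (cases "i = j")
    case True
    then show ?thesis using mom(3,4)[of i] ij by (simp add: power2_eq_square)
  next
    case False
    have ind: "indep_vars (\<lambda>_. borel) ?Z {i, j}"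
      by (rule indep_vars_subset[OF bm_indep_increments[OF bm step_nodes_le[OF assms(2,3)]]])
        (use ij in auto)
    have int: "integrable M (?Z k)" if "k \<in> {i, j}" for k using mom(1) that ij by auto
    from indep_vars_lebesgue_integral[OF _ ind int] indep_vars_integrable[OF _ ind int]
    show ?thesis using False mom(2) ij by auto
  qed
  have sq: "(step_integral W n u c \<omega>)\<^sup>2 = (\<Sum>i<n. \<Sum>j<n. c i * c j * (?Z i \<omega> * ?Z j \<omega>))" for \<omega>
    unfolding step_integral_def power2_eq_square sum_product by (simp add: algebra_simps)
  have int: "integrable M (\<lambda>\<omega>. (step_integral W n u c \<omega>)\<^sup>2)"
    unfolding sq using cov by (intro Bochner_Integration.integrable_sum integrable_mult_right) auto
  have "expectation (\<lambda>\<omega>. (step_integral W n u c \<omega>)\<^sup>2) =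
      (\<Sum>i<n. \<Sum>j<n. c i * c j * expectation (\<lambda>\<omega>. ?Z i \<omega> * ?Z j \<omega>))"
    unfolding sq using cov
    by (subst Bochner_Integration.integral_sum,
        (intro Bochner_Integration.integrable_sum integrable_mult_right; simp),
        intro sum.cong refl, subst Bochner_Integration.integral_sum) (auto intro!: integrable_mult_right)
  also have "\<dots> = (\<Sum>i<n. \<Sum>j<n. if i = j then (c i)\<^sup>2 * (u (Suc i) - u i) else 0)"
    using cov by (intro sum.cong refl) (auto simp: power2_eq_square)
  also have "\<dots> = (\<Sum>i<n. (c i)\<^sup>2 * (u (Suc i) - u i))" by (simp add: sum.delta)
  finally show ?thesis using int by (subst nn_integral_eq_integral) auto
qed

text \<open>
  Where \<open>g \<ge> 0\<close>, the negative part of a step function \<open>h\<close> is dominated by \<open>\<bar>h - g\<bar>\<close>, so by the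
  isometry the integral of \<open>h\<close> may be replaced by that of its positive part.
\<close>
lemma has_wiener_integral_nonneg_step:
  assumes bm: "standard_brownian_motion M T W" and t: "t \<le> T"
    and Y: "has_wiener_integral M W t g Y"
    and g: "AE s in lebesgue_on {0..t}. 0 \<le> g s"
    and "0 < \<epsilon>"
  shows "\<exists>n u c. step_nodes t n u \<and> (\<forall>i. 0 \<le> c i) \<and>
    (\<integral>\<^sup>+ \<omega>. ennreal ((step_integral W n u c \<omega> - Y \<omega>)\<^sup>2) \<partial>M) < ennreal \<epsilon>"
proof -
  obtain n u c where nodes: "\<And>k. step_nodes t (n k) (u k)"
    and lim1: "(\<lambda>k. \<integral>\<^sup>+ s. ennreal ((step_fun (n k) (u k) (c k) s - g s)\<^sup>2) \<partial>lebesgue_on {0..t}) \<longlonglongrightarrow> 0"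
    and lim2: "(\<lambda>k. \<integral>\<^sup>+ \<omega>. ennreal ((step_integral W (n k) (u k) (c k) \<omega> - Y \<omega>)\<^sup>2) \<partial>M) \<longlonglongrightarrow> 0"
    using Y unfolding has_wiener_integral_def by blast
  have "\<forall>\<^sub>F k in sequentially.
      (\<integral>\<^sup>+ s. ennreal ((step_fun (n k) (u k) (c k) s - g s)\<^sup>2) \<partial>lebesgue_on {0..t}) < ennreal (\<epsilon> / 4)
    \<and> (\<integral>\<^sup>+ \<omega>. ennreal ((step_integral W (n k) (u k) (c k) \<omega> - Y \<omega>)\<^sup>2) \<partial>M) < ennreal (\<epsilon> / 4)"
    using \<open>0 < \<epsilon>\<close> by (intro eventually_conj order_tendstoD(2)[OF lim1] order_tendstoD(2)[OF lim2]) auto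
  \<comment> \<open>Two errors below \<open>\<epsilon> / 4\<close> suffice, because a squared sum is
    at most twice the sum of the squares.\<close>
  then obtain k where
    k1: "(\<integral>\<^sup>+ s. ennreal ((step_fun (n k) (u k) (c k) s - g s)\<^sup>2) \<partial>lebesgue_on {0..t}) < ennreal (\<epsilon> / 4)"
    and k2: "(\<integral>\<^sup>+ \<omega>. ennreal ((step_integral W (n k) (u k) (c k) \<omega> - Y \<omega>)\<^sup>2) \<partial>M) < ennreal (\<epsilon> / 4)"
    using eventually_happens'[OF sequentially_bot] by blast
  \<comment> \<open>With \<open>p\<close> and \<open>q\<close> the positive and negative parts of
    the coefficients, replacing \<open>c k\<close> by \<open>p\<close> adds exactly the integral of
    \<open>q\<close>. The isometry measures this on \<open>{0..t}\<close>, the only place where the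
    sign of \<open>g\<close> can be used.\<close>
  define p where "p i = max 0 (c k i)" for i
  define q where "q i = max 0 (- c k i)" for i
  let ?I = "step_integral W (n k) (u k)"
  note nk = nodes[of k]
  have [measurable]: "?I d \<in> borel_measurable M" for d
    by (rule borel_measurable_step_integral[OF bm nk t])
  have [measurable]: "Y \<in> borel_measurable M" using Y by (simp add: has_wiener_integral_def)
  have pq: "?I p \<omega> - ?I (c k) \<omega> = ?I q \<omega>" for \<omega>
    unfolding step_integral_def sum_subtractf[symmetric]
    by (intro sum.cong refl) (auto simp: p_def q_def max_def algebra_simps)
  have "(\<integral>\<^sup>+ \<omega>. ennreal ((?I q \<omega>)\<^sup>2) \<partial>M) =
      (\<integral>\<^sup>+ s. ennreal ((step_fun (n k) (u k) q s)\<^sup>2) \<partial>lebesgue_on {0..t})"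
    by (simp add: nn_integral_step_integral_sq[OF bm nk t] nn_integral_step_fun_sq[OF nk])
  also have "\<dots> \<le> (\<integral>\<^sup>+ s. ennreal ((step_fun (n k) (u k) (c k) s - g s)\<^sup>2) \<partial>lebesgue_on {0..t})"
  proof (rule nn_integral_mono_AE, use g in eventually_elim)
    case (elim s)
    have "(step_fun (n k) (u k) q s)\<^sup>2 \<le> (step_fun (n k) (u k) (c k) s - g s)\<^sup>2"
    proof (rule step_fun_cases[OF nk, of s])
      fix i assume "\<And>d. step_fun (n k) (u k) d s = d i"
      then show ?thesis using elim by (auto simp: q_def max_def abs_le_square_iff[symmetric])
    qed simp
    then show ?case by (rule ennreal_leI)
  qed
  finally have q: "(\<integral>\<^sup>+ \<omega>. ennreal ((?I q \<omega>)\<^sup>2) \<partial>M) < ennreal (\<epsilon> / 4)"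
    using k1 by (rule le_less_trans)
  have "(\<integral>\<^sup>+ \<omega>. ennreal ((?I p \<omega> - Y \<omega>)\<^sup>2) \<partial>M) \<le>
      (\<integral>\<^sup>+ \<omega>. ennreal 2 * ennreal ((?I q \<omega>)\<^sup>2) + ennreal 2 * ennreal ((?I (c k) \<omega> - Y \<omega>)\<^sup>2) \<partial>M)"
  proof (rule nn_integral_mono)
    fix \<omega>
    have eq: "?I p \<omega> - Y \<omega> = ?I q \<omega> + (?I (c k) \<omega> - Y \<omega>)" using pq[of \<omega>] by simp
    have "(?I p \<omega> - Y \<omega>)\<^sup>2 \<le> 2 * (?I q \<omega>)\<^sup>2 + 2 * (?I (c k) \<omega> - Y \<omega>)\<^sup>2"
      unfolding eq using sum_squares_bound[of "?I q \<omega>" "?I (c k) \<omega> - Y \<omega>"] by (simp add: power2_sum)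
    then have "ennreal ((?I p \<omega> - Y \<omega>)\<^sup>2) \<le> ennreal (2 * (?I q \<omega>)\<^sup>2 + 2 * (?I (c k) \<omega> - Y \<omega>)\<^sup>2)"
      by (rule ennreal_leI)
    then show "ennreal ((?I p \<omega> - Y \<omega>)\<^sup>2) \<le>
        ennreal 2 * ennreal ((?I q \<omega>)\<^sup>2) + ennreal 2 * ennreal ((?I (c k) \<omega> - Y \<omega>)\<^sup>2)"
      by (simp add: ennreal_plus ennreal_mult del: ennreal_numeral)
  qed
  also have "\<dots> = ennreal 2 * (\<integral>\<^sup>+ \<omega>. ennreal ((?I q \<omega>)\<^sup>2) \<partial>M) +
      ennreal 2 * (\<integral>\<^sup>+ \<omega>. ennreal ((?I (c k) \<omega> - Y \<omega>)\<^sup>2) \<partial>M)"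
    by (subst nn_integral_add) (auto simp: nn_integral_cmult simp del: ennreal_numeral)
  also have "\<dots> < ennreal 2 * ennreal (\<epsilon> / 4) + ennreal 2 * ennreal (\<epsilon> / 4)"
    using q k2 by (intro add_strict_mono ennreal_mult_strict_left_mono) auto
  also have "\<dots> = ennreal \<epsilon>"
    using \<open>0 < \<epsilon>\<close> by (simp add: ennreal_mult[symmetric] ennreal_plus[symmetric] del: ennreal_numeral ennreal_plus)
  finally show ?thesis
    using nk by (intro exI[of _ "n k"] exI[of _ "u k"] exI[of _ p]) (auto simp: p_def)
qed

text \<open>An increment telescopes over the finer nodes, with coefficients 0 and 1. They are chosen
  before \<open>w\<close>, so the same coefficients serve every Brownian path.\<close>

lemma increments_refinement:
  assumes "finite S" "S \<subseteq> {0..T}" "0 \<le> T"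
  shows "\<exists>m v. step_nodes T m v \<and> (\<forall>a\<in>S. \<forall>b\<in>S. a \<le> b \<longrightarrow>
      (\<exists>d. (\<forall>l. 0 \<le> d l) \<and>
        (\<forall>w::real \<Rightarrow> real. w b - w a = (\<Sum>l<m. d l * (w (v (Suc l)) - w (v l))))))"
proof -
  \<comment> \<open>Inserting 0 guarantees at least one node even if \<open>S\<close> is
    empty.\<close>
  define xs where "xs = sorted_list_of_set (insert 0 S)"
  have xs: "set xs = insert 0 S" "sorted xs"
    unfolding xs_def using assms
    by (simp_all only: set_sorted_list_of_set sorted_sorted_list_of_set finite_insert)
  then have "xs \<noteq> []" by auto
  define m where "m = length xs - 1"
  define v where "v l = xs ! l" for l
  have len: "length xs = Suc m" using \<open>xs \<noteq> []\<close> by (simp add: m_def)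
  have nodes: "step_nodes T m v"
    unfolding step_nodes_def
  proof (intro conjI allI impI)
    fix i assume "i \<le> m"
    then have "v i \<in> set xs" by (simp add: v_def len)
    then show "v i \<in> {0..T}" using xs(1) assms by auto
  next
    fix i assume "i < m"
    then show "v i \<le> v (Suc i)" unfolding v_def using xs(2) len by (intro sorted_nth_mono) auto
  qed
  have "\<exists>d. (\<forall>l. 0 \<le> d l) \<and> (\<forall>w::real \<Rightarrow> real. w b - w a = (\<Sum>l<m. d l * (w (v (Suc l)) - w (v l))))"
    if ab: "a \<in> S" "b \<in> S" "a \<le> b" for a b
  proof -
    have "a \<in> set xs" "b \<in> set xs" using ab xs(1) by auto
    then obtain p q where pq: "a = v p" "p \<le> m" "b = v q" "q \<le> m"
      by (auto simp: in_set_conv_nth len v_def less_Suc_eq_le)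
    show ?thesis
    proof (cases "p \<le> q")
      case True
      have "w b - w a = (\<Sum>l<m. indicator {p..<q} l * (w (v (Suc l)) - w (v l)))" for w :: "real \<Rightarrow> real"
      proof -
        have "w b - w a = (\<Sum>l\<in>{p..<q}. w (v (Suc l)) - w (v l))"
          using True sum_Suc_diff'[of p q "\<lambda>l. w (v l)"] by (simp add: pq)
        also have "\<dots> = (\<Sum>l<m. indicator {p..<q} l * (w (v (Suc l)) - w (v l)))"
          using pq by (intro sum.mono_neutral_cong_left) auto
        finally show ?thesis .
      qed
      then show ?thesis by (intro exI[of _ "indicator {p..<q}"]) auto
    next
      \<comment> \<open>Order between indices is recovered only from \<open>a \<le> b\<close>;
        indices in the wrong order force \<open>a = b\<close> and a zero increment.\<close>
      case False
      then have "v q \<le> v p" using pq by (intro step_nodes_mono[OF nodes]) auto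
      then have "a = b" using ab pq by simp
      then show ?thesis by (intro exI[of _ "\<lambda>_. 0"]) auto
    qed
  qed
  then show ?thesis using nodes by blast
qed

text \<open>Increments over overlapping intervals are not independent. Passing to the union of all
  nodes expresses the whole family through one independent sequence, and the new coefficients
  \<open>D\<close> remain nonnegative as sums of products of nonnegative numbers.\<close>

lemma step_integrals_refinement:
  fixes n :: "'i \<Rightarrow> nat" and u c :: "'i \<Rightarrow> nat \<Rightarrow> real"
  assumes "finite K" "0 \<le> T" and nodes: "\<And>k. k \<in> K \<Longrightarrow> step_nodes T (n k) (u k)"
    and c: "\<And>k i. 0 \<le> c k i"
  obtains m v D where "step_nodes T m v" "\<And>k l. 0 \<le> D k l"
    "\<And>k W (\<omega>::'w). k \<in> K \<Longrightarrow> step_integral W (n k) (u k) (c k) \<omega> =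
      (\<Sum>l<m. D k l * (W (v (Suc l)) \<omega> - W (v l) \<omega>))"
proof -
  define S where "S = (\<Union>k\<in>K. u k ` {..n k})"
  have "finite S" "S \<subseteq> {0..T}" using assms by (auto simp: S_def step_nodes_def)
  obtain m v where v: "step_nodes T m v"
    and ref: "\<forall>a\<in>S. \<forall>b\<in>S. a \<le> b \<longrightarrow> (\<exists>d. (\<forall>l. 0 \<le> d l) \<and>
      (\<forall>w::real \<Rightarrow> real. w b - w a = (\<Sum>l<m. d l * (w (v (Suc l)) - w (v l)))))"
    using increments_refinement[OF \<open>finite S\<close> \<open>S \<subseteq> _\<close> \<open>0 \<le> T\<close>] by blast
  \<comment> \<open>Keeping the conditions on \<open>k\<close> and \<open>i\<close> inside the
    existential makes the choice of \<open>d\<close> total, with nonnegativity unconditional and 0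
    as default.\<close>
  have "\<exists>d. (\<forall>l. 0 \<le> d l) \<and> (k \<in> K \<longrightarrow> i < n k \<longrightarrow> (\<forall>w::real \<Rightarrow> real.
      w (u k (Suc i)) - w (u k i) = (\<Sum>l<m. d l * (w (v (Suc l)) - w (v l)))))" for k i
  proof (cases "k \<in> K \<and> i < n k")
    case True
    then have "u k (Suc i) \<in> S" "u k i \<in> S" "u k i \<le> u k (Suc i)"
      using nodes[of k] unfolding S_def step_nodes_def by (blast intro: Suc_leI less_imp_le)+
    with ref show ?thesis by blast
  qed (auto intro: exI[of _ "\<lambda>_. 0"])
  then obtain d where d: "\<And>k i l. 0 \<le> d k i l"
    "\<And>k i w. k \<in> K \<Longrightarrow> i < n k \<Longrightarrow>
      (w::real \<Rightarrow> real) (u k (Suc i)) - w (u k i) = (\<Sum>l<m. d k i l * (w (v (Suc l)) - w (v l)))"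
    by metis
  define D where "D k l = (\<Sum>i<n k. c k i * d k i l)" for k l
  show ?thesis
  proof (rule that[OF v])
    show "0 \<le> D k l" for k l unfolding D_def using c d(1) by (intro sum_nonneg) auto
    fix k W and \<omega> :: 'w assume k: "k \<in> K"
    have "step_integral W (n k) (u k) (c k) \<omega> =
        (\<Sum>i<n k. \<Sum>l<m. c k i * d k i l * (W (v (Suc l)) \<omega> - W (v l) \<omega>))"
      unfolding step_integral_def
      using d(2)[OF k, of _ "\<lambda>s. W s \<omega>"] by (intro sum.cong refl) (simp add: sum_distrib_left mult.assoc)
    also have "\<dots> = (\<Sum>l<m. D k l * (W (v (Suc l)) \<omega> - W (v l) \<omega>))"
      by (subst sum.swap) (simp add: D_def sum_distrib_right)
    finally show "step_integral W (n k) (u k) (c k) \<omega> = \<dots>" .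
  qed
qed


section \<open>Association of Liouville processes\<close>

text \<open>The integrand of \<open>X t\<close> is the reflected function \<open>f (t - s)\<close>.
  Reflection is differentiable and so preserves null sets, which carries the sign of
  \<open>f\<close> over to the integrand.\<close>

lemma AE_lebesgue_on_reflect:
  fixes P :: "real \<Rightarrow> bool"
  assumes "AE s in lebesgue_on {0..T}. P s" "t \<le> T"
  shows "AE s in lebesgue_on {0..t}. P (t - s)"
proof -
  have "AE s in lebesgue. s \<in> {0..T} \<longrightarrow> P s"
    using assms(1) by (simp add: AE_restrict_space_iff)
  then obtain N where N: "negligible N" "{s. \<not> (s \<in> {0..T} \<longrightarrow> P s)} \<subseteq> N"
    unfolding eventually_ae_filter_negligible by blast
  have "negligible ((\<lambda>s. t - s) ` N)"
    by (rule negligible_differentiable_image_negligible[OF _ N(1)]) (auto intro!: derivative_intros)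
  moreover have "{s. \<not> (s \<in> {0..t} \<longrightarrow> P (t - s))} \<subseteq> (\<lambda>s. t - s) ` N"
  proof
    fix s assume "s \<in> {s. \<not> (s \<in> {0..t} \<longrightarrow> P (t - s))}"
    then have "t - s \<in> N" using N(2) assms(2) by auto
    then show "s \<in> (\<lambda>s. t - s) ` N" by (rule rev_image_eqI) simp
  qed
  ultimately have "AE s in lebesgue. s \<in> {0..t} \<longrightarrow> P (t - s)"
    unfolding eventually_ae_filter_negligible by blast
  then show ?thesis by (simp add: AE_restrict_space_iff)
qed

lemma measurable_lin_comb_rv:
  assumes "0 \<le> T" "\<And>l. l < m \<Longrightarrow> continuous_on {0..T} (e l)"
    and A: "\<And>l. l < m \<Longrightarrow> A l \<in> borel_measurable M"
  shows "(\<lambda>\<omega>. lin_comb T m e (\<lambda>l. A l \<omega>)) \<in> measurable M (C_borel T)"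
proof -
  have "(\<lambda>\<omega>. \<lambda>l\<in>{..<m}. A l \<omega>) \<in> measurable M (Pi\<^sub>M {..<m} (\<lambda>_. borel))"
    using A by (intro measurable_restrict) auto
  from measurable_compose[OF this measurable_lin_comb[OF assms(1,2)]] show ?thesis
    by (simp add: lin_comb_def)
qed

text \<open>Both signs meet here: coefficients and basis functions are nonnegative, so raising any
  increment raises the whole path. Composing with \<open>F\<close> or \<open>G\<close> then gives a
  monotone function of independent variables.\<close>

lemma step_integral_paths_association:
  assumes bm: "standard_brownian_motion M T W" and T: "0 \<le> T"
    and nodes: "\<And>k. k < K \<Longrightarrow> step_nodes T (n k) (u k)" and c: "\<And>k i. 0 \<le> c k i"
    and b: "\<And>k. k < K \<Longrightarrow> continuous_on {0..T} (b k)"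
      "\<And>k t. k < K \<Longrightarrow> t \<in> {0..T} \<Longrightarrow> 0 \<le> b k t"
    and FG: "F \<in> borel_measurable (C_borel T)" "G \<in> borel_measurable (C_borel T)"
      "C_nondecreasing T F" "C_nondecreasing T G"
    and bd: "\<And>x. x \<in> mspace (C_metric T) \<Longrightarrow> \<bar>F x\<bar> \<le> B"
      "\<And>x. x \<in> mspace (C_metric T) \<Longrightarrow> \<bar>G x\<bar> \<le> B"
  defines "Y \<equiv> \<lambda>\<omega>. lin_comb T K b (\<lambda>k. step_integral W (n k) (u k) (c k) \<omega>)"
  shows "(\<integral>\<omega>. F (Y \<omega>) \<partial>M) * (\<integral>\<omega>. G (Y \<omega>) \<partial>M) \<le> (\<integral>\<omega>. F (Y \<omega>) * G (Y \<omega>) \<partial>M)"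
proof -
  interpret prob_space M using bm by (simp add: standard_brownian_motion_def)
  obtain m v D where v: "step_nodes T m v" and D: "\<And>k l. (0::real) \<le> D k l"
    and SI: "\<And>k W (\<omega>::'a). k \<in> {..<K} \<Longrightarrow> step_integral W (n k) (u k) (c k) \<omega> =
      (\<Sum>l<m. D k l * (W (v (Suc l)) \<omega> - W (v l) \<omega>))"
    by (rule step_integrals_refinement[of "{..<K}" T n u c]) (use nodes c T in auto)
  define Z where "Z l \<omega> = W (v (Suc l)) \<omega> - W (v l) \<omega>" for l \<omega>
  \<comment> \<open>\<open>e l\<close> is the response of the whole path to the increment number
    \<open>l\<close>; the double sum is regrouped by increments.\<close>
  define e where "e l t = (\<Sum>k<K. D k l * b k t)" for l t
  have e: "continuous_on {0..T} (e l)" for l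
    unfolding e_def using b(1) by (intro continuous_intros) auto
  have e0: "0 \<le> e l t" if "t \<in> {0..T}" for l t
    unfolding e_def using b(2)[OF _ that] D by (intro sum_nonneg) auto
  have Y: "Y \<omega> = lin_comb T m e (\<lambda>l\<in>{..<m}. Z l \<omega>)" for \<omega>
    unfolding Y_def lin_comb_def
  proof (rule restrict_ext)
    fix t
    have "(\<Sum>k<K. step_integral W (n k) (u k) (c k) \<omega> * b k t) = (\<Sum>k<K. \<Sum>l<m. D k l * Z l \<omega> * b k t)"
      by (simp add: SI Z_def sum_distrib_right)
    also have "\<dots> = (\<Sum>l<m. Z l \<omega> * e l t)"
      by (subst sum.swap) (simp add: e_def sum_distrib_left ac_simps)
    finally show "(\<Sum>k<K. step_integral W (n k) (u k) (c k) \<omega> * b k t) =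
        (\<Sum>l<m. (\<lambda>l\<in>{..<m}. Z l \<omega>) l * e l t)" by simp
  qed
  have lc: "lin_comb T m e z \<in> mspace (C_metric T)" for z
    by (rule lin_comb_in_mspace[OF e])
  have mono: "F (lin_comb T m e x) \<le> F (lin_comb T m e y)"
    if "C_nondecreasing T F" "\<And>l. l \<in> {..<m} \<Longrightarrow> x l \<le> y l" for F x y
  proof -
    have "lin_comb T m e x t \<le> lin_comb T m e y t" if "t \<in> {0..T}" for t
      using that \<open>\<And>l. l \<in> {..<m} \<Longrightarrow> x l \<le> y l\<close> e0
      by (auto simp: lin_comb_def intro!: sum_mono mult_right_mono)
    then show ?thesis
      using \<open>C_nondecreasing T F\<close> lc unfolding C_nondecreasing_def by blast
  qed
  have ind: "indep_vars (\<lambda>_. borel) Z {..<m}"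
    using bm_indep_increments[OF bm v] by (simp add: Z_def[abs_def])
  show ?thesis
    unfolding Y
    by (rule indep_vars_harris_inequality[OF _ ind, where B = B])
      (use bd lc mono FG measurable_compose[OF measurable_lin_comb[OF T e]] in auto)
qed

section \<open>Bernstein approximation and passage to the limit\<close>

lemma Bernstein_rescaled_uniform_limit:
  assumes "0 < T" and x: "continuous_on {0..T} x"
  shows "uniform_limit {0..T} (\<lambda>N t. \<Sum>k<Suc N. x (T * (k / N)) * Bernstein N k (t / T)) x sequentially"
proof (rule uniform_limitI)
  fix r :: real assume "0 < r"
  have "continuous_on {0..1} (\<lambda>s. x (T * s))"
    by (rule continuous_on_compose2[OF x]) (use assms(1) in \<open>auto intro!: continuous_intros mult_left_le\<close>)
  from Bernstein_Weierstrass[OF this \<open>0 < r\<close>] obtain N0 where N0: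
    "\<And>N s. N0 \<le> N \<Longrightarrow> s \<in> {0..1} \<Longrightarrow> \<bar>x (T * s) - (\<Sum>k\<le>N. x (T * (k / N)) * Bernstein N k s)\<bar> < r"
    by blast
  have "dist (\<Sum>k<Suc N. x (T * (k / N)) * Bernstein N k (t / T)) (x t) < r"
    if "N0 \<le> N" "t \<in> {0..T}" for N t
    using N0[OF that(1), of "t / T"] that(2) assms(1)
    by (simp add: dist_real_def abs_minus_commute lessThan_Suc_atMost)
  then show "\<forall>\<^sub>F N in sequentially. \<forall>t\<in>{0..T}.
      dist (\<Sum>k<Suc N. x (T * (k / N)) * Bernstein N k (t / T)) (x t) < r"
    unfolding eventually_sequentially by blast
qed

text \<open>Treating nondecreasing pairs is enough: changing both signs makes a nonincreasing pair
  nondecreasing and leaves all products unchanged.\<close>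

lemma liouville_association:
  fixes M :: "'w measure"
  assumes T: "0 < T" and bm: "standard_brownian_motion M T W"
    and X: "continuous_liouville_process M W T f X"
    and f: "AE s in lebesgue_on {0..T}. 0 \<le> f s"
    and F: "F \<in> borel_measurable (C_borel T)" "C_nondecreasing T F" "as_continuous M T X F"
      "bounded (F ` mspace (C_metric T))"
    and G: "G \<in> borel_measurable (C_borel T)" "C_nondecreasing T G" "as_continuous M T X G"
      "bounded (G ` mspace (C_metric T))"
  shows "(LINT \<omega>|M. F (path T X \<omega>)) * (LINT \<omega>|M. G (path T X \<omega>))
    \<le> (LINT \<omega>|M. F (path T X \<omega>) * G (path T X \<omega>))"
proof -
  interpret prob_space M using bm by (simp add: standard_brownian_motion_def)
  let ?C = "mspace (C_metric T)"
  have "0 \<le> T" using T by simp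
  have Xcont: "continuous_on {0..T} (\<lambda>t. X t \<omega>)" if "\<omega> \<in> space M" for \<omega>
    using X that by (simp add: continuous_liouville_process_def)
  have wi: "has_wiener_integral M W t (\<lambda>s. f (t - s)) (X t)" if "t \<in> {0..T}" for t
    using X that by (simp add: continuous_liouville_process_def)
  have Xm[measurable]: "X t \<in> borel_measurable M" if "t \<in> {0..T}" for t
    using wi[OF that] by (simp add: has_wiener_integral_def)
  have path_C: "path T X \<omega> \<in> ?C" if "\<omega> \<in> space M" for \<omega>
  proof -
    have "continuous_on {0..T} (path T X \<omega>)"
      using Xcont[OF that] by (rule continuous_on_eq) (simp add: path_def)
    then show ?thesis by (simp add: mspace_C_metric path_def)
  qed
  \<comment> \<open>The cap at 1 keeps \<open>\<tau> N k\<close> in \<open>{0..T}\<close> for every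
    \<open>k\<close>, so the step integrals can be chosen for all pairs at once. For
    \<open>k < Suc N\<close> it is the Bernstein node, including \<open>N = 0\<close>, where
    division by zero gives 0.\<close>
  define \<tau> where "\<tau> N k = T * min 1 (real k / real N)" for N k :: nat
  have \<tau>: "\<tau> N k \<in> {0..T}" for N k
    using T by (auto simp: \<tau>_def intro!: mult_left_le)
  have \<tau>_eq: "\<tau> N k = T * (k / N)" if "k < Suc N" for N k
  proof -
    have "real k / real N \<le> 1" using that by (cases "N = 0") auto
    then show ?thesis by (simp add: \<tau>_def)
  qed
  define b where "b N k t = Bernstein N k (t / T)" for N k t
  have b: "continuous_on {0..T} (b N k)" "\<And>t. t \<in> {0..T} \<Longrightarrow> 0 \<le> b N k t" for N k
    using T by (auto simp: b_def Bernstein_def[abs_def] intro!: continuous_intros mult_nonneg_nonneg)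
  have b_sum: "(\<Sum>k<Suc N. b N k t) = 1" for N t
    by (simp add: b_def lessThan_Suc_atMost del: sum.lessThan_Suc)
  define P where "P N \<omega> = lin_comb T (Suc N) (b N) (\<lambda>k. X (\<tau> N k) \<omega>)" for N \<omega>
  have P_lim: "uniform_limit {0..T} (\<lambda>N. P N \<omega>) (path T X \<omega>) sequentially"
    if \<omega>: "\<omega> \<in> space M" for \<omega>
    using Bernstein_rescaled_uniform_limit[OF T Xcont[OF \<omega>]]
  proof (rule uniform_limit_cong'[THEN iffD1, rotated 2])
    fix t assume t: "t \<in> {0..T}"
    then show "X t \<omega> = path T X \<omega> t" by (simp add: path_def)
    show "(\<Sum>k<Suc N. X (T * (real k / real N)) \<omega> * Bernstein N k (t / T)) = P N \<omega> t" for N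
      using t \<tau>_eq
      by (auto simp: P_def lin_comb_def b_def simp del: sum.lessThan_Suc intro!: sum.cong)
  qed
  have P_meas: "P N \<in> measurable M (C_borel T)" for N
    unfolding P_def by (rule measurable_lin_comb_rv[OF \<open>0 \<le> T\<close> b(1) Xm[OF \<tau>]])
  \<comment> \<open>The Bernstein paths \<open>P N\<close> depend on finitely many values of
    \<open>X\<close> and are measurable for that reason; their limit inherits it. This is what
    allows statements about the law of \<open>X\<close> to be pulled back to
    \<open>M\<close>.\<close>
  have path_meas: "path T X \<in> measurable M (C_borel T)"
    by (rule measurable_C_borel_uniform_limit[OF \<open>0 \<le> T\<close> P_meas path_C P_lim])
  \<comment> \<open>There are N+1 coefficients at level N, so the factor 1/(N+1) leaves a total
    squared error of mean at most \<open>(1/2) ^ N\<close>, which is summable.\<close>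
  define Q where "Q N k n u c \<longleftrightarrow> step_nodes T n u \<and> (\<forall>i. 0 \<le> c i) \<and>
      step_integral W n u c \<in> borel_measurable M \<and>
      (\<integral>\<^sup>+ \<omega>. ennreal ((step_integral W n u c \<omega> - X (\<tau> N k) \<omega>)\<^sup>2) \<partial>M) < ennreal ((1/2) ^ N / Suc N)"
    for N k n u c
  have "\<exists>n u c. Q N k n u c"
    for N k
  proof -
    have le: "\<tau> N k \<le> T" using \<tau>[of N k] by simp
    have "0 < (1/2) ^ N / real (Suc N)" by simp
    then obtain n u c where nu: "step_nodes (\<tau> N k) n u" and c: "\<And>i. 0 \<le> c i"
      and less: "(\<integral>\<^sup>+ \<omega>. ennreal ((step_integral W n u c \<omega> - X (\<tau> N k) \<omega>)\<^sup>2) \<partial>M)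
        < ennreal ((1/2) ^ N / real (Suc N))"
      using has_wiener_integral_nonneg_step[OF bm le wi[OF \<tau>] AE_lebesgue_on_reflect[OF f le]]
      by blast
    from step_nodes_le[OF nu le] borel_measurable_step_integral[OF bm nu le] c less
    show ?thesis unfolding Q_def by blast
  qed
  then obtain n u c where "\<And>N k. Q N k (n N k) (u N k) (c N k)" by metis
  then have nodes: "\<And>N k. step_nodes T (n N k) (u N k)" and c: "\<And>N k i. 0 \<le> c N k i"
    and Am': "\<And>N k. step_integral W (n N k) (u N k) (c N k) \<in> borel_measurable M"
    and A': "\<And>N k. (\<integral>\<^sup>+ \<omega>. ennreal ((step_integral W (n N k) (u N k) (c N k) \<omega> - X (\<tau> N k) \<omega>)\<^sup>2) \<partial>M)
      < ennreal ((1/2) ^ N / Suc N)"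
    unfolding Q_def by blast+
  define A where "A N k = step_integral W (n N k) (u N k) (c N k)" for N k
  have Am[measurable]: "A N k \<in> borel_measurable M" for N k unfolding A_def by (rule Am')
  have A: "(\<integral>\<^sup>+ \<omega>. ennreal ((A N k \<omega> - X (\<tau> N k) \<omega>)\<^sup>2) \<partial>M) \<le> ennreal ((1/2) ^ N / Suc N)" for N k
    using A'[of N k] unfolding A_def by (rule less_imp_le)
  define Y where "Y N \<omega> = lin_comb T (Suc N) (b N) (\<lambda>k. A N k \<omega>)" for N \<omega>
  have Y_meas: "Y N \<in> measurable M (C_borel T)" for N
    unfolding Y_def by (rule measurable_lin_comb_rv[OF \<open>0 \<le> T\<close> b(1) Am])
  have Y_C: "Y N \<omega> \<in> ?C" for N \<omega> unfolding Y_def by (rule lin_comb_in_mspace[OF b(1)])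
  \<comment> \<open>The square root of this sum dominates all coefficient errors of level
    \<open>N\<close> at once.\<close>
  define S where "S N \<omega> = (\<Sum>k<Suc N. (A N k \<omega> - X (\<tau> N k) \<omega>)\<^sup>2)" for N \<omega>
  have S_nonneg: "0 \<le> S N \<omega>" for N \<omega>
    unfolding S_def by (rule sum_nonneg) simp
  have Sm[measurable]: "S N \<in> borel_measurable M" for N
    unfolding S_def using \<tau> by measurable
  have S_nn: "(\<integral>\<^sup>+ \<omega>. ennreal (S N \<omega>) \<partial>M) \<le> ennreal ((1/2) ^ N)" for N
  proof -
    have "(\<integral>\<^sup>+ \<omega>. ennreal (S N \<omega>) \<partial>M) = (\<Sum>k<Suc N. \<integral>\<^sup>+ \<omega>. ennreal ((A N k \<omega> - X (\<tau> N k) \<omega>)\<^sup>2) \<partial>M)"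
      unfolding S_def using \<tau>
      by (subst nn_integral_sum[symmetric]) (auto simp: sum_ennreal[symmetric] simp del: sum_ennreal sum.lessThan_Suc)
    also have "\<dots> \<le> (\<Sum>k<Suc N. ennreal ((1/2) ^ N / Suc N))" by (rule sum_mono) (rule A)
    also have "\<dots> = ennreal (\<Sum>k<Suc N. (1/2) ^ N / Suc N)" by (rule sum_ennreal) simp
    also have "(\<Sum>k<Suc N. (1/2) ^ N / Suc N) = ((1/2) ^ N :: real)"
      by (simp only: sum_constant card_lessThan) simp
    finally show ?thesis .
  qed
  have "AE \<omega> in M. (\<Sum>N. ennreal (S N \<omega>)) \<noteq> \<infinity>"
  proof (rule nn_integral_PInf_AE)
    have "(\<integral>\<^sup>+ \<omega>. (\<Sum>N. ennreal (S N \<omega>)) \<partial>M) = (\<Sum>N. \<integral>\<^sup>+ \<omega>. ennreal (S N \<omega>) \<partial>M)"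
      by (rule nn_integral_suminf) simp
    also have "\<dots> \<le> (\<Sum>N. ennreal ((1/2) ^ N))" by (rule suminf_le[OF S_nn]) auto
    also have "\<dots> = ennreal (\<Sum>N. (1/2) ^ N)" by (rule suminf_ennreal2) (auto intro: summable_geometric)
    also have "\<dots> < \<infinity>" by simp
    finally show "(\<integral>\<^sup>+ \<omega>. (\<Sum>N. ennreal (S N \<omega>)) \<partial>M) \<noteq> \<infinity>" by simp
  qed measurable
  then have S_lim: "AE \<omega> in M. (\<lambda>N. S N \<omega>) \<longlonglongrightarrow> 0"
  proof eventually_elim
    case (elim \<omega>)
    then have "summable (\<lambda>N. S N \<omega>)"
      by (intro summable_suminf_not_top S_nonneg) auto
    then show ?case by (rule summable_LIMSEQ_zero)
  qed
  \<comment> \<open>At each \<open>t\<close> the difference is an average of the coefficient errors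
    with weights \<open>b N k t\<close>, so the bound is uniform in \<open>t\<close>.\<close>
  have Y_P: "\<bar>Y N \<omega> t - P N \<omega> t\<bar> \<le> sqrt (S N \<omega>)" if t: "t \<in> {0..T}" for N \<omega> t
  proof -
    have "\<bar>A N k \<omega> - X (\<tau> N k) \<omega>\<bar> \<le> sqrt (S N \<omega>)" if "k < Suc N" for k
      unfolding S_def using that
      by (intro real_le_rsqrt) (auto simp del: sum.lessThan_Suc intro!: member_le_sum)
    then have "(\<Sum>k<Suc N. \<bar>A N k \<omega> - X (\<tau> N k) \<omega>\<bar> * b N k t) \<le> (\<Sum>k<Suc N. sqrt (S N \<omega>) * b N k t)"
      using b(2)[OF t] by (intro sum_mono mult_right_mono) auto
    also have "\<dots> = sqrt (S N \<omega>)"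
      by (simp add: sum_distrib_left[symmetric] b_sum del: sum.lessThan_Suc)
    finally have *: "(\<Sum>k<Suc N. \<bar>A N k \<omega> - X (\<tau> N k) \<omega>\<bar> * b N k t) \<le> sqrt (S N \<omega>)" .
    have "Y N \<omega> t - P N \<omega> t = (\<Sum>k<Suc N. (A N k \<omega> - X (\<tau> N k) \<omega>) * b N k t)"
      using t by (simp add: Y_def P_def lin_comb_def sum_subtractf left_diff_distrib del: sum.lessThan_Suc)
    also have "\<bar>\<dots>\<bar> \<le> (\<Sum>k<Suc N. \<bar>A N k \<omega> - X (\<tau> N k) \<omega>\<bar> * b N k t)"
      using b(2)[OF t] by (intro order_trans[OF sum_abs] sum_mono) (simp add: abs_mult)
    finally show ?thesis using * by linarith
  qed
  have Y_lim: "AE \<omega> in M. uniform_limit {0..T} (\<lambda>N. Y N \<omega>) (path T X \<omega>) sequentially"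
    using S_lim AE_space
  proof eventually_elim
    case (elim \<omega>)
    have sq: "(\<lambda>N. sqrt (S N \<omega>)) \<longlonglongrightarrow> 0" using tendsto_real_sqrt[OF elim(1)] by simp
    show ?case
    proof (rule uniform_limitI)
      fix r :: real assume "0 < r"
      have "\<forall>\<^sub>F N in sequentially. \<forall>t\<in>{0..T}. dist (P N \<omega> t) (path T X \<omega> t) < r / 2"
        using uniform_limitD[OF P_lim[OF elim(2)], of "r / 2"] \<open>0 < r\<close> by simp
      moreover have "\<forall>\<^sub>F N in sequentially. sqrt (S N \<omega>) < r / 2"
        using order_tendstoD(2)[OF sq, of "r / 2"] \<open>0 < r\<close> by simp
      ultimately show "\<forall>\<^sub>F N in sequentially. \<forall>t\<in>{0..T}. dist (Y N \<omega> t) (path T X \<omega> t) < r"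
      proof eventually_elim
        case (elim N)
        show ?case
        proof
          fix t assume t: "t \<in> {0..T}"
          have "\<bar>P N \<omega> t - path T X \<omega> t\<bar> < r / 2" using elim(1) t by (simp add: dist_real_def)
          then show "dist (Y N \<omega> t) (path T X \<omega> t) < r"
            using Y_P[OF t, of N \<omega>] elim(2) unfolding dist_real_def by linarith
        qed
      qed
    qed
  qed
  have conv: "AE \<omega> in M. (\<lambda>N. H (Y N \<omega>)) \<longlonglongrightarrow> H (path T X \<omega>)" if "as_continuous M T X H" for H
  proof -
    have "AE \<omega> in M. topcontinuous_at (mtopology_of (C_metric T)) euclideanreal H (path T X \<omega>)"
      using AE_distrD[OF path_meas that[unfolded as_continuous_def]] .
    with Y_lim show ?thesis
    proof eventually_elim
      case (elim \<omega>)
      show ?case by (rule topcontinuous_at_C_tendsto[OF \<open>0 \<le> T\<close> elim(2) Y_C elim(1)])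
    qed
  qed
  obtain B1 where B1: "\<And>x. x \<in> ?C \<Longrightarrow> \<bar>F x\<bar> \<le> B1" using F(4) by (auto simp: bounded_iff)
  obtain B2 where B2: "\<And>x. x \<in> ?C \<Longrightarrow> \<bar>G x\<bar> \<le> B2" using G(4) by (auto simp: bounded_iff)
  define B where "B = max B1 B2"
  have BF: "\<bar>F x\<bar> \<le> B" and BG: "\<bar>G x\<bar> \<le> B" if "x \<in> ?C" for x
    using B1[OF that] B2[OF that] by (auto simp: B_def)
  have BFG: "\<bar>F x * G x\<bar> \<le> B * B" if "x \<in> ?C" for x
    unfolding abs_mult using BF[OF that] BG[OF that] by (intro mult_mono) auto
  have int_lim: "(\<lambda>N. \<integral>\<omega>. H (Y N \<omega>) \<partial>M) \<longlonglongrightarrow> (\<integral>\<omega>. H (path T X \<omega>) \<partial>M)"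
    if H: "H \<in> borel_measurable (C_borel T)" "\<And>x. x \<in> ?C \<Longrightarrow> \<bar>H x\<bar> \<le> K"
      "AE \<omega> in M. (\<lambda>N. H (Y N \<omega>)) \<longlonglongrightarrow> H (path T X \<omega>)"
    for H :: "(real \<Rightarrow> real) \<Rightarrow> real" and K
  proof (rule integral_dominated_convergence[where w = "\<lambda>_. K"])
    show "(\<lambda>\<omega>. H (path T X \<omega>)) \<in> borel_measurable M" "\<And>N. (\<lambda>\<omega>. H (Y N \<omega>)) \<in> borel_measurable M"
      using measurable_compose[OF path_meas H(1)] measurable_compose[OF Y_meas H(1)] by auto
    show "AE \<omega> in M. norm (H (Y N \<omega>)) \<le> K" for N using H(2)[OF Y_C] by simp
  qed (use H(3) in auto)
  have FGm: "(\<lambda>x. F x * G x) \<in> borel_measurable (C_borel T)" using F(1) G(1) by measurable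
  have FGc: "AE \<omega> in M. (\<lambda>N. F (Y N \<omega>) * G (Y N \<omega>)) \<longlonglongrightarrow> F (path T X \<omega>) * G (path T X \<omega>)"
    using conv[OF F(3)] conv[OF G(3)] by eventually_elim (rule tendsto_mult)
  show ?thesis
  proof (rule LIMSEQ_le)
    show "(\<lambda>N. (\<integral>\<omega>. F (Y N \<omega>) \<partial>M) * (\<integral>\<omega>. G (Y N \<omega>) \<partial>M)) \<longlonglongrightarrow>
        (LINT \<omega>|M. F (path T X \<omega>)) * (LINT \<omega>|M. G (path T X \<omega>))"
      by (intro tendsto_mult int_lim[OF F(1) BF conv[OF F(3)]] int_lim[OF G(1) BG conv[OF G(3)]])
    show "(\<lambda>N. \<integral>\<omega>. F (Y N \<omega>) * G (Y N \<omega>) \<partial>M) \<longlonglongrightarrow> (LINT \<omega>|M. F (path T X \<omega>) * G (path T X \<omega>))"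
      by (rule int_lim[OF FGm BFG FGc])
    have "(\<integral>\<omega>. F (Y N \<omega>) \<partial>M) * (\<integral>\<omega>. G (Y N \<omega>) \<partial>M) \<le> (\<integral>\<omega>. F (Y N \<omega>) * G (Y N \<omega>) \<partial>M)" for N
      unfolding Y_def A_def
      by (rule step_integral_paths_association[OF bm \<open>0 \<le> T\<close> nodes c b F(1) G(1) F(2) G(2) BF BG])
    then show "\<exists>N. \<forall>k\<ge>N. (\<integral>\<omega>. F (Y k \<omega>) \<partial>M) * (\<integral>\<omega>. G (Y k \<omega>) \<partial>M)
        \<le> (\<integral>\<omega>. F (Y k \<omega>) * G (Y k \<omega>) \<partial>M)" by blast
  qed
qed

lemma as_continuous_uminus:
  assumes "as_continuous M T X F"
  shows "as_continuous M T X (\<lambda>x. - F x)"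
  using assms unfolding as_continuous_def
proof eventually_elim
  case (elim x)
  show ?case
    unfolding topcontinuous_at_def
  proof (intro conjI allI impI)
    fix V assume V: "openin euclideanreal V \<and> - F x \<in> V"
    then have "openin euclideanreal (uminus ` V)" "F x \<in> uminus ` V"
      using open_negations[of V] by (auto simp: open_openin[symmetric] image_iff intro!: bexI[of _ "- F x"])
    then obtain U where "openin (mtopology_of (C_metric T)) U" "x \<in> U" "\<And>y. y \<in> U \<Longrightarrow> F y \<in> uminus ` V"
      using elim unfolding topcontinuous_at_def by metis
    then show "\<exists>U. openin (mtopology_of (C_metric T)) U \<and> x \<in> U \<and> (\<forall>y\<in>U. - F y \<in> V)"
      by (intro exI[of _ U]) force
  qed (use elim in \<open>auto simp: topcontinuous_at_def\<close>)
qed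

theorem proposition4p2:
  fixes M :: "'w measure"
    and W X :: "real \<Rightarrow> 'w \<Rightarrow> real"
    and f :: "real \<Rightarrow> real"
    and T \<rho> a :: real
  assumes "prob_space M"
    and "0 < T"
    and "standard_brownian_motion M T W"
    and "0 < \<rho>" "\<rho> \<le> 1" "0 < a"
    and "L_condition T \<rho> a f"
    and "continuous_liouville_process M W T f X"
    and "AE s in lebesgue_on {0..T}. 0 \<le> f s"
  shows "functional_co_monotony_principle M T X"
  unfolding functional_co_monotony_principle_def
proof (intro allI impI, elim conjE)
  fix F G
  assume F: "F \<in> borel_measurable (C_borel T)" "bounded (F ` mspace (C_metric T))" "as_continuous M T X F"
    and G: "G \<in> borel_measurable (C_borel T)" "bounded (G ` mspace (C_metric T))" "as_continuous M T X G"
    and "co_monotone T F G"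
  note assoc = liouville_association[OF assms(2,3,8,9)]
  from \<open>co_monotone T F G\<close> consider "C_nondecreasing T F" "C_nondecreasing T G"
    | "C_nonincreasing T F" "C_nonincreasing T G"
    by (auto simp: co_monotone_def)
  then show "(LINT \<omega>|M. F (path T X \<omega>)) * (LINT \<omega>|M. G (path T X \<omega>))
      \<le> (LINT \<omega>|M. F (path T X \<omega>) * G (path T X \<omega>))"
  proof cases
    case 1
    then show ?thesis using F G by (intro assoc)
  next
    \<comment> \<open>Applied to \<open>- F\<close> and \<open>- G\<close>, the nondecreasing case
      gives the claim, as the signs cancel on both sides.\<close>
    case 2
    have bd: "bounded ((\<lambda>x. - H x) ` mspace (C_metric T))" if "bounded (H ` mspace (C_metric T))"
      for H :: "(real \<Rightarrow> real) \<Rightarrow> real"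
      using that by (simp add: bounded_iff)
    have "(LINT \<omega>|M. - F (path T X \<omega>)) * (LINT \<omega>|M. - G (path T X \<omega>))
        \<le> (LINT \<omega>|M. - F (path T X \<omega>) * - G (path T X \<omega>))"
      using 2 F G
      by (intro assoc as_continuous_uminus bd) (auto simp: C_nondecreasing_def C_nonincreasing_def)
    then show ?thesis by simp
  qed
qed

end
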